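(* Let $\bar A$ be the set of primes $p$ with $p\equiv 2 \pmod 3$ for which there exist $\alpha,\beta,\gamma,\mu,\nu\in\mathbb{N}=\{1,2,\dots\}$ and primes $q,r$ with $\gcd(6,qr)=1$ such that $p+1=2^\alpha 3^\beta q^\mu$ and $p-1=2^\gamma r^\nu$. Let $\bar A_{\le x}=\{p\in\bar A: p\le x\}$ and $\mathfrak{S}_A=9\prod_{p\ge 5\text{ prime}}(1-\frac3p)(1-\frac1p)^{-3}$. Then, unconditionally, $$\limsup_{x\to\infty}\frac{|\bar A_{\le x}|}{x/(\log x)^3}\le 24\,\mathfrak{S}_A.$$
   Context: $\log$ denotes the natural logarithm. *)

theory Defs
  imports "HOL-Number_Theory.Number_Theory" "HOL-Analysis.Analysis"
begin

definition A_bar :: "nat set" where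
  "A_bar = {p. prime p \<and> [p = 2] (mod 3) \<and>
     (\<exists>(\<alpha>::nat) (\<beta>::nat) (\<gamma>::nat) (\<mu>::nat) (\<nu>::nat) (q::nat) (r::nat).
        \<alpha> \<ge> 1 \<and> \<beta> \<ge> 1 \<and> \<gamma> \<ge> 1 \<and> \<mu> \<ge> 1 \<and> \<nu> \<ge> 1 \<and>
        prime q \<and> prime r \<and> gcd 6 (q * r) = 1 \<and>
        p + 1 = 2 ^ \<alpha> * 3 ^ \<beta> * q ^ \<mu> \<and>
        p - 1 = 2 ^ \<gamma> * r ^ \<nu>)}"

definition A_bar_le :: "real \<Rightarrow> nat set" where
  "A_bar_le x = {p \<in> A_bar. real p \<le> x}"

(* The product over primes is an infinite product over all n with the factor 1
   at every n that is not a prime \<ge> 5; its factors are 1 + O(1/n^2) and nonzero,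
   so it converges absolutely and the order of the factors is immaterial. *)
definition singular_series_A :: real where
  "singular_series_A =
     9 * (\<Prod>n. if prime n \<and> n \<ge> 5
                then (1 - 3 / real n) * inverse ((1 - 1 / real n) ^ 3) else 1)"

end

theory Submission
  imports Defs "HOL-Computational_Algebra.Squarefree" "HOL-Real_Asymp.Real_Asymp"
begin

text \<open>
  The exponents \<open>\<mu>, \<nu> \<ge> 2\<close> contribute only \<open>O(sqrt x (log x)\<^sup>3)\<close> primes.  If \<open>\<mu> = \<nu> = 1\<close>, write \<open>p + 1 = 2aq\<close> and
  \<open>p - 1 = 2br\<close>; since one of two consecutive even numbers is \<open>2\<close> modulo \<open>4\<close>, either
  \<open>(a, b) = (2\<^sup>i 3\<^sup>j, 1)\<close> or \<open>(a, b) = (3\<^sup>j, 2\<^sup>i)\<close> with \<open>i, j \<ge> 1\<close>.  For fixed \<open>(a, b)\<close> the solutions of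
  \<open>aq - br = 1\<close> form a progression, and \<open>p, q, r\<close> are three linear forms in its parameter \<open>t\<close>.  Together
  they exclude three classes of \<open>t\<close> modulo every prime \<open>l \<ge> 5\<close> and, by choosing one form, a single class modulo \<open>2\<close> and \<open>3\<close>,
  whatever \<open>(a, b)\<close> is.  Selberg's sieve of level \<open>z = x\<^sup>h\<close> with fixed \<open>h < 1/2\<close> therefore bounds each
  count by \<open>x / (2 a b G(z))\<close> with one and the same \<open>G\<close>, with an error \<open>O(x\<^sup>1\<^sup>-\<^sup>\<eta>)\<close> uniform in \<open>(a, b)\<close>.  As
  \<open>\<Sum> 1/(2 a b) = 1/2\<close> over all pairs and \<open>G(z) \<ge> (1 - o(1)) (log z)\<^sup>3 / (6 \<SS>)\<close>, where \<open>\<SS>\<close> is the singular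
  series, letting \<open>h\<close> tend to \<open>1/2\<close> gives the constant \<open>6 \<cdot> 2\<^sup>3 / 2 = 24\<close>.

  For the lower bound on \<open>G\<close>, fix a threshold \<open>w\<close> and let \<open>W\<close> be the product of the primes up to \<open>w\<close>.
  The primes up to \<open>w\<close> contribute their full Euler product.  The part coprime to \<open>W\<close> dominates the sum of
  \<open>1/(abc)\<close> over triples coprime to \<open>W\<close> with squarefree product \<open>abc \<le> z/W\<close>, and the non-squarefree products
  lose at most the fraction \<open>6/w\<close>.
\<close>

section \<open>Selberg's upper bound sieve\<close>

text \<open>A squarefree number is represented by its set of prime factors, so \<open>D\<close> is the set of admissible
  divisors, union is the least common multiple and \<open>(-1) ^ card T\<close> is the Moebius function.\<close>

locale selberg_sieve =
  fixes P :: "'a set" and D :: "'a set set" and \<rho> :: "'a \<Rightarrow> real"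
  assumes finite_P: "finite P"
    and D_subset: "T \<in> D \<Longrightarrow> T \<subseteq> P"
    and D_down: "T \<in> D \<Longrightarrow> K \<subseteq> T \<Longrightarrow> K \<in> D"
    and empty_in_D: "{} \<in> D"
    and rho_pos: "p \<in> P \<Longrightarrow> 0 < \<rho> p"
    and rho_less_1: "p \<in> P \<Longrightarrow> \<rho> p < 1"
begin

definition G :: "'a set \<Rightarrow> real" where
  "G T = (\<Prod>p\<in>T. \<rho> p / (1 - \<rho> p))"

definition S :: real where
  "S = (\<Sum>T\<in>D. G T)"

text \<open>Selberg's optimal weights: the minimiser of the quadratic form in
  \<open>quadratic_form_weight\<close> among all weights supported on \<open>D\<close> with value 1
  at \<open>{}\<close>.\<close>

definition weight :: "'a set \<Rightarrow> real" where
  "weight T = (-1) ^ card T / (\<Prod>p\<in>T. \<rho> p) * (\<Sum>M\<in>{M \<in> D. T \<subseteq> M}. G M) / S"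

section \<open>The optimal weights and the diagonalised quadratic form\<close>

lemma finite_D: "finite D"
  by (rule finite_subset[of _ "Pow P"]) (use D_subset finite_P in auto)

lemma finite_member: "T \<in> D \<Longrightarrow> finite T"
  using D_subset finite_P finite_subset by blast

lemma G_pos: "T \<in> D \<Longrightarrow> G T > 0"
  unfolding G_def by (rule prod_pos) (use D_subset rho_pos rho_less_1 in fastforce)

lemma rho_prod_pos: "T \<in> D \<Longrightarrow> (\<Prod>p\<in>T. \<rho> p) > 0"
  by (rule prod_pos) (use D_subset rho_pos in blast)

lemma S_ge_1: "S \<ge> 1"
proof -
  have "(\<Sum>T\<in>{{}}. G T) \<le> S"
    unfolding S_def by (rule sum_mono2) (use finite_D empty_in_D G_pos in \<open>auto intro: less_imp_le\<close>)
  thus ?thesis by (simp add: G_def)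
qed

lemma weight_empty: "weight {} = 1"
  using S_ge_1 by (simp add: weight_def S_def)

text \<open>Expanding the product of \<open>(1 - \<rho> p) / \<rho> p + 1 = 1 / \<rho> p\<close>
  over \<open>T\<close> gives one term \<open>1 / G K\<close> for each subset
  \<open>K\<close>.\<close>

lemma sum_inverse_G:
  assumes "T \<in> D"
  shows "(\<Sum>K\<in>Pow T. 1 / G K) = 1 / (\<Prod>p\<in>T. \<rho> p)"
proof -
  have "(\<Sum>K\<in>Pow T. 1 / G K) = (\<Sum>K\<in>Pow T. (\<Prod>p\<in>K. (1 - \<rho> p) / \<rho> p) * (\<Prod>p\<in>T-K. 1))"
    by (simp add: G_def prod_dividef)
  also have "\<dots> = (\<Prod>p\<in>T. (1 - \<rho> p) / \<rho> p + 1)"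
    by (rule prod_add[symmetric]) (use assms finite_member in auto)
  also have "\<dots> = (\<Prod>p\<in>T. 1 / \<rho> p)"
  proof (rule prod.cong)
    fix p assume "p \<in> T"
    then have "\<rho> p > 0" using D_subset assms rho_pos by blast
    thus "(1 - \<rho> p) / \<rho> p + 1 = 1 / \<rho> p" by (simp add: field_simps)
  qed simp
  finally show ?thesis by (simp add: prod_dividef)
qed

text \<open>This separates \<open>T1\<close> from \<open>T2\<close>: the density of the least common
  multiple becomes a sum over common divisors \<open>K\<close> of products of a factor in
  \<open>T1\<close> and a factor in \<open>T2\<close>, which is what diagonalises the quadratic
  form. It is \<open>sum_inverse_G\<close> applied to \<open>T1 \<inter> T2\<close>.\<close>

lemma rho_Un:
  assumes "T1 \<in> D" "T2 \<in> D"
  shows "(\<Prod>p\<in>T1 \<union> T2. \<rho> p) =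
    (\<Prod>p\<in>T1. \<rho> p) * (\<Prod>p\<in>T2. \<rho> p) * (\<Sum>K\<in>D. if K \<subseteq> T1 \<and> K \<subseteq> T2 then 1 / G K else 0)"
proof -
  have I: "T1 \<inter> T2 \<in> D" using D_down assms by blast
  have "(\<Sum>K\<in>D. if K \<subseteq> T1 \<and> K \<subseteq> T2 then 1 / G K else 0) = (\<Sum>K\<in>Pow (T1 \<inter> T2). 1 / G K)"
    unfolding sum.inter_filter[OF finite_D, symmetric]
    by (rule sum.cong) (use D_down I in blast)+
  also have "\<dots> = 1 / (\<Prod>p\<in>T1 \<inter> T2. \<rho> p)" by (rule sum_inverse_G[OF I])
  finally have *: "(\<Sum>K\<in>D. if K \<subseteq> T1 \<and> K \<subseteq> T2 then 1 / G K else 0) = 1 / (\<Prod>p\<in>T1 \<inter> T2. \<rho> p)" .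
  have "(\<Prod>p\<in>T1 \<union> T2. \<rho> p) * (\<Prod>p\<in>T1 \<inter> T2. \<rho> p) = (\<Prod>p\<in>T1. \<rho> p) * (\<Prod>p\<in>T2. \<rho> p)"
    by (rule prod.union_inter) (use assms finite_member in auto)
  with rho_prod_pos[OF I] show ?thesis unfolding * by (simp add: field_simps)
qed

text \<open>Moebius cancellation on the interval between \<open>K\<close> and \<open>M\<close>:
  after factoring out the sign of \<open>K\<close>, the sum expands the product of
  \<open>-1 + 1\<close> over \<open>M - K\<close>.\<close>

lemma alternating_interval_sum:
  assumes "finite M" "K \<subseteq> M"
  shows "(\<Sum>T\<in>{T. K \<subseteq> T \<and> T \<subseteq> M}. (-1) ^ card T) = (if K = M then (-1) ^ card K else (0::real))"
proof -
  have fin: "finite K" using assms finite_subset by blast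
  have "(\<Sum>T\<in>{T. K \<subseteq> T \<and> T \<subseteq> M}. (-1) ^ card T) = (\<Sum>X\<in>Pow (M - K). (-1) ^ card (K \<union> X) :: real)"
    by (rule sum.reindex_bij_witness[of _ "\<lambda>X. K \<union> X" "\<lambda>T. T - K"])
       (use assms in \<open>auto simp: Un_absorb1\<close>)
  also have "\<dots> = (\<Sum>X\<in>Pow (M - K). (-1) ^ card K * ((\<Prod>p\<in>X. -1) * (\<Prod>p\<in>M-K-X. 1)))"
  proof (rule sum.cong)
    fix X assume "X \<in> Pow (M - K)"
    hence "card (K \<union> X) = card K + card X"
      using assms fin finite_subset[of X M] by (intro card_Un_disjoint) auto
    thus "(-1) ^ card (K \<union> X) = ((-1) ^ card K * ((\<Prod>p\<in>X. -1) * (\<Prod>p\<in>M-K-X. 1)) :: real)"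
      by (simp add: power_add)
  qed simp
  also have "\<dots> = (-1) ^ card K * (\<Prod>p\<in>M-K. -1 + 1)"
    by (subst prod_add) (use assms in \<open>auto simp: sum_distrib_left\<close>)
  also have "\<dots> = (if K = M then (-1) ^ card K else 0)"
    using assms by (auto simp: card_gt_0_iff)
  finally show ?thesis .
qed

text \<open>The left side is the diagonal coordinate of the weights at \<open>K\<close>. Inserting
  the definition of \<open>weight\<close> and swapping the sums leaves an alternating sum over the
  sets between \<open>K\<close> and \<open>M\<close>, which survives only for
  \<open>M = K\<close>.\<close>

lemma weight_diagonal:
  assumes K: "K \<in> D"
  shows "(\<Sum>T\<in>D. if K \<subseteq> T then (\<Prod>p\<in>T. \<rho> p) * weight T else 0) = (-1) ^ card K * G K / S"
proof -
  have "(\<Sum>T\<in>D. if K \<subseteq> T then (\<Prod>p\<in>T. \<rho> p) * weight T else 0) =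
      (\<Sum>T\<in>D. \<Sum>M\<in>D. if K \<subseteq> T \<and> T \<subseteq> M then (-1) ^ card T * G M / S else 0)"
  proof (rule sum.cong)
    fix T assume T: "T \<in> D"
    have "(\<Sum>M\<in>D. if K \<subseteq> T \<and> T \<subseteq> M then (-1) ^ card T * G M / S else 0) =
       (if K \<subseteq> T then (-1) ^ card T * (\<Sum>M\<in>{M\<in>D. T \<subseteq> M}. G M) / S else 0)"
      by (simp add: finite_D sum.inter_filter sum_distrib_left sum_divide_distrib)
         (auto intro!: sum.cong)
    thus "(if K \<subseteq> T then (\<Prod>p\<in>T. \<rho> p) * weight T else 0) = 
        (\<Sum>M\<in>D. if K \<subseteq> T \<and> T \<subseteq> M then (-1) ^ card T * G M / S else 0)"
      using rho_prod_pos[OF T] by (simp add: weight_def)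
  qed simp
  also have "\<dots> = (\<Sum>M\<in>D. \<Sum>T\<in>D. if K \<subseteq> T \<and> T \<subseteq> M then (-1) ^ card T * G M / S else 0)"
    by (rule sum.swap)
  also have "\<dots> = (\<Sum>M\<in>D. if K = M then (-1) ^ card K * G K / S else 0)"
  proof (rule sum.cong)
    fix M assume M: "M \<in> D"
    have "(\<Sum>T\<in>D. if K \<subseteq> T \<and> T \<subseteq> M then (-1) ^ card T * G M / S else 0) =
       (\<Sum>T\<in>{T. K \<subseteq> T \<and> T \<subseteq> M}. (-1) ^ card T * G M / S)"
      unfolding sum.inter_filter[OF finite_D, symmetric]
      by (rule sum.cong) (use D_down M in auto)
    also have "\<dots> = (\<Sum>T\<in>{T. K \<subseteq> T \<and> T \<subseteq> M}. (-1) ^ card T) * G M / S"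
      by (simp add: sum_distrib_right sum_divide_distrib)
    also have "\<dots> = (if K = M then (-1) ^ card K * G K / S else 0)"
    proof (cases "K \<subseteq> M")
      case True
      thus ?thesis using alternating_interval_sum[of M K] finite_member[OF M] by simp
    next
      case False
      hence "{T. K \<subseteq> T \<and> T \<subseteq> M} = {}" "K \<noteq> M" by auto
      thus ?thesis by (simp only: sum.empty if_False mult_zero_left div_0)
    qed
    finally show "(\<Sum>T\<in>D. if K \<subseteq> T \<and> T \<subseteq> M then (-1) ^ card T * G M / S else 0) =
      (if K = M then (-1) ^ card K * G K / S else 0)" .
  qed simp
  also have "\<dots> = (-1) ^ card K * G K / S" using K finite_D by simp
  finally show ?thesis .
qed

text \<open>In the diagonal coordinates the form is the sum of \<open>1 / G K\<close> times the
  square of the coordinate at \<open>K\<close>, that is of \<open>G K / S^2\<close>, and the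
  \<open>G K\<close> add up to \<open>S\<close>.\<close>

lemma quadratic_form_weight:
  "(\<Sum>T1\<in>D. \<Sum>T2\<in>D. weight T1 * weight T2 * (\<Prod>p\<in>T1 \<union> T2. \<rho> p)) = 1 / S"
proof -
  let ?v = "\<lambda>K T. if K \<subseteq> T then (\<Prod>p\<in>T. \<rho> p) * weight T else 0"
  have "(\<Sum>T1\<in>D. \<Sum>T2\<in>D. weight T1 * weight T2 * (\<Prod>p\<in>T1 \<union> T2. \<rho> p)) =
     (\<Sum>T1\<in>D. \<Sum>T2\<in>D. \<Sum>K\<in>D. 1 / G K * (?v K T1 * ?v K T2))"
    by (intro sum.cong refl, subst rho_Un)
       (auto simp: sum_distrib_left intro!: sum.cong)
  also have "\<dots> = (\<Sum>T1\<in>D. \<Sum>K\<in>D. \<Sum>T2\<in>D. 1 / G K * (?v K T1 * ?v K T2))"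
    by (intro sum.cong refl sum.swap)
  also have "\<dots> = (\<Sum>K\<in>D. \<Sum>T1\<in>D. \<Sum>T2\<in>D. 1 / G K * (?v K T1 * ?v K T2))"
    by (rule sum.swap)
  also have "\<dots> = (\<Sum>K\<in>D. 1 / G K * ((\<Sum>T1\<in>D. ?v K T1) * (\<Sum>T2\<in>D. ?v K T2)))"
    unfolding sum_product by (simp only: sum_distrib_left)
  also have "\<dots> = (\<Sum>K\<in>D. G K / S^2)"
  proof (rule sum.cong)
    fix K assume K: "K \<in> D"
    have "((-1) ^ card K * G K / S) * ((-1) ^ card K * G K / S) = G K ^ 2 / S ^ 2"
      by (simp add: power2_eq_square)
    thus "1 / G K * ((\<Sum>T1\<in>D. ?v K T1) * (\<Sum>T2\<in>D. ?v K T2)) = G K / S^2"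
      unfolding weight_diagonal[OF K] using G_pos[OF K] by (simp add: power2_eq_square)
  qed simp
  also have "\<dots> = 1 / S"
    using S_ge_1 by (simp add: power2_eq_square S_def flip: sum_divide_distrib)
  finally show ?thesis .
qed

text \<open>Writing \<open>G M = G T * G (M - T)\<close> and noting that
  \<open>M \<mapsto> M - T\<close> is injective on supersets of \<open>T\<close> and stays in the
  downward closed \<open>D\<close>, the sum in the weight is at most \<open>G T * S\<close>.\<close>

lemma abs_weight_le:
  assumes T: "T \<in> D"
  shows "\<bar>weight T\<bar> \<le> (\<Prod>p\<in>T. 1 / (1 - \<rho> p))"
proof -
  have "(\<Sum>M\<in>{M \<in> D. T \<subseteq> M}. G M) = (\<Sum>M\<in>{M \<in> D. T \<subseteq> M}. G T * G (M - T))"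
  proof (rule sum.cong)
    fix M assume "M \<in> {M \<in> D. T \<subseteq> M}"
    thus "G M = G T * G (M - T)"
      unfolding G_def using prod.subset_diff[of T M] finite_member by (simp add: mult.commute)
  qed simp
  also have "\<dots> = G T * (\<Sum>M\<in>{M \<in> D. T \<subseteq> M}. G (M - T))" by (simp add: sum_distrib_left)
  also have "(\<Sum>M\<in>{M \<in> D. T \<subseteq> M}. G (M - T)) = (\<Sum>K\<in>(\<lambda>M. M - T) ` {M \<in> D. T \<subseteq> M}. G K)"
    by (subst sum.reindex) (auto simp: inj_on_def)
  also have "\<dots> \<le> S"
    unfolding S_def by (rule sum_mono2) (use finite_D D_down G_pos in \<open>auto intro: less_imp_le\<close>)
  finally have *: "(\<Sum>M\<in>{M \<in> D. T \<subseteq> M}. G M) \<le> G T * S"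
    using G_pos[OF T] by (simp add: mult_left_mono)
  have "\<bar>weight T\<bar> = (\<Sum>M\<in>{M \<in> D. T \<subseteq> M}. G M) / (\<Prod>p\<in>T. \<rho> p) / S"
    using S_ge_1 rho_prod_pos[OF T] G_pos
    by (simp add: weight_def abs_mult, intro abs_of_nonneg sum_nonneg) (auto intro: less_imp_le)
  also have "\<dots> \<le> G T * S / (\<Prod>p\<in>T. \<rho> p) / S"
    using * S_ge_1 rho_prod_pos[OF T] by (intro divide_right_mono) auto
  also have "\<dots> = G T / (\<Prod>p\<in>T. \<rho> p)" using S_ge_1 by simp
  also have "\<dots> = (\<Prod>p\<in>T. 1 / (1 - \<rho> p))"
    using rho_prod_pos[OF T] by (simp add: G_def prod_dividef)
  finally show ?thesis .
qed

text \<open>The square of the sum of the weights over the divisors dividing \<open>n\<close>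
  majorises the indicator of the sifted set: if no prime is bad for \<open>n\<close>, only
  \<open>{}\<close> contributes, with weight 1. Expanding the square and counting each union gives
  the quadratic form plus the discrepancies.\<close>

theorem selberg_upper_bound:
  fixes A :: "'b set" and bad :: "'a \<Rightarrow> 'b \<Rightarrow> bool" and X :: real and R :: "'a set \<Rightarrow> real"
  assumes A: "finite A"
    and dist: "\<And>T. T \<subseteq> P \<Longrightarrow> 
      \<bar>real (card {n \<in> A. \<forall>p\<in>T. bad p n}) - X * (\<Prod>p\<in>T. \<rho> p)\<bar> \<le> R T"
  shows "real (card {n \<in> A. \<forall>p\<in>P. \<not> bad p n}) \<le>
     X / S + (\<Sum>T1\<in>D. \<Sum>T2\<in>D. \<bar>weight T1\<bar> * \<bar>weight T2\<bar> * R (T1 \<union> T2))"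
proof -
  let ?w = "\<lambda>n T. if \<forall>p\<in>T. bad p n then weight T else 0"
  have "real (card {n \<in> A. \<forall>p\<in>P. \<not> bad p n}) = (\<Sum>n\<in>A. if \<forall>p\<in>P. \<not> bad p n then 1 else 0)"
    using A by (simp flip: sum.inter_filter)
  also have "\<dots> \<le> (\<Sum>n\<in>A. (\<Sum>T\<in>D. ?w n T)\<^sup>2)"
  proof (rule sum_mono)
    fix n assume "n \<in> A"
    show "(if \<forall>p\<in>P. \<not> bad p n then 1 else 0) \<le> (\<Sum>T\<in>D. ?w n T)\<^sup>2"
    proof (cases "\<forall>p\<in>P. \<not> bad p n")
      case True
      have "(\<Sum>T\<in>D. ?w n T) = (\<Sum>T\<in>D. if T = {} then 1 else 0)"
        by (intro sum.cong refl) (use True D_subset weight_empty in \<open>force\<close>)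
      also have "\<dots> = 1" using finite_D empty_in_D by simp
      finally show ?thesis by simp
    next
      case False
      thus ?thesis by (simp only: if_False zero_le_power2)
    qed
  qed
  also have "\<dots> = (\<Sum>n\<in>A. \<Sum>T1\<in>D. \<Sum>T2\<in>D. ?w n T1 * ?w n T2)"
    by (simp add: power2_eq_square sum_product)
  also have "\<dots> = (\<Sum>T1\<in>D. \<Sum>n\<in>A. \<Sum>T2\<in>D. ?w n T1 * ?w n T2)"
    by (rule sum.swap)
  also have "\<dots> = (\<Sum>T1\<in>D. \<Sum>T2\<in>D. \<Sum>n\<in>A. ?w n T1 * ?w n T2)"
    by (intro sum.cong refl sum.swap)
  also have "\<dots> = (\<Sum>T1\<in>D. \<Sum>T2\<in>D. weight T1 * weight T2 * card {n \<in> A. \<forall>p\<in>T1 \<union> T2. bad p n})"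
  proof (intro sum.cong refl)
    fix T1 T2
    have "(\<Sum>n\<in>A. ?w n T1 * ?w n T2) =
        (\<Sum>n\<in>A. if \<forall>p\<in>T1 \<union> T2. bad p n then weight T1 * weight T2 else 0)"
      by (intro sum.cong refl) auto
    also have "\<dots> = weight T1 * weight T2 * card {n \<in> A. \<forall>p\<in>T1 \<union> T2. bad p n}"
      using A by (simp flip: sum.inter_filter)
    finally show "(\<Sum>n\<in>A. ?w n T1 * ?w n T2) = \<dots>" .
  qed
  also have "\<dots> \<le> (\<Sum>T1\<in>D. \<Sum>T2\<in>D. X * (weight T1 * weight T2 * (\<Prod>p\<in>T1 \<union> T2. \<rho> p)) +
      \<bar>weight T1\<bar> * \<bar>weight T2\<bar> * R (T1 \<union> T2))"
  proof (intro sum_mono)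
    fix T1 T2 assume "T1 \<in> D" "T2 \<in> D"
    hence "T1 \<union> T2 \<subseteq> P" using D_subset by blast
    let ?c = "real (card {n \<in> A. \<forall>p\<in>T1 \<union> T2. bad p n})"
    let ?r = "?c - X * (\<Prod>p\<in>T1 \<union> T2. \<rho> p)"
    have "weight T1 * weight T2 * ?r \<le> \<bar>weight T1 * weight T2\<bar> * \<bar>?r\<bar>"
      unfolding abs_mult[symmetric] by (rule abs_ge_self)
    also have "\<dots> \<le> \<bar>weight T1 * weight T2\<bar> * R (T1 \<union> T2)"
      by (intro mult_left_mono dist \<open>T1 \<union> T2 \<subseteq> P\<close>) simp
    finally show "weight T1 * weight T2 * ?c \<le> X * (weight T1 * weight T2 * (\<Prod>p\<in>T1 \<union> T2. \<rho> p)) +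
      \<bar>weight T1\<bar> * \<bar>weight T2\<bar> * R (T1 \<union> T2)" by (simp add: algebra_simps abs_mult)
  qed
  also have "\<dots> = X / S + (\<Sum>T1\<in>D. \<Sum>T2\<in>D. \<bar>weight T1\<bar> * \<bar>weight T2\<bar> * R (T1 \<union> T2))"
    unfolding sum.distrib sum_distrib_left[symmetric] quadratic_form_weight by simp
  finally show ?thesis .
qed

end

section \<open>Sieving an interval\<close>

lemma card_residue_class:
  fixes N m a :: nat
  assumes "m > 0"
  shows "\<bar>real (card {n. n < N \<and> [n = a] (mod m)}) - real N / real m\<bar> \<le> 1"
proof -
  define a' where "a' = a mod m"
  have a': "a' < m" using assms by (simp add: a'_def)
  let ?A = "{n. n < N \<and> [n = a] (mod m)}"
  have "?A = (\<lambda>k. a' + m * k) ` {k. a' + m * k < N}"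
  proof (intro equalityI subsetI)
    fix n assume "n \<in> ?A"
    hence "n mod m = a'" "n < N" by (auto simp: unique_euclidean_semiring_class.cong_def a'_def)
    hence "n = a' + m * (n div m)" by (metis add.commute mult_div_mod_eq)
    thus "n \<in> (\<lambda>k. a' + m * k) ` {k. a' + m * k < N}" using \<open>n < N\<close> by force
  next
    fix n assume "n \<in> (\<lambda>k. a' + m * k) ` {k. a' + m * k < N}"
    thus "n \<in> ?A" using a' by (auto simp: unique_euclidean_semiring_class.cong_def a'_def)
  qed
  hence card: "card ?A = card {k. a' + m * k < N}"
    using assms by (simp add: card_image inj_on_def)
  let ?q = "N div m"
  have N: "N = m * ?q + N mod m" "N mod m < m" using assms by auto
  have "{..<?q} \<subseteq> {k. a' + m * k < N}"
  proof
    fix k assume "k \<in> {..<?q}"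
    hence "k + 1 \<le> ?q" by simp
    hence "m * (k + 1) \<le> m * ?q" by (rule mult_le_mono2)
    hence "m * k + m \<le> m * ?q" by (simp add: algebra_simps)
    also have "\<dots> \<le> N" by simp
    finally have "m * k + m \<le> N" .
    hence "a' + m * k < N" using a' by linarith
    thus "k \<in> {k. a' + m * k < N}" by simp
  qed
  moreover have sub: "{k. a' + m * k < N} \<subseteq> {..?q}"
  proof
    fix k assume "k \<in> {k. a' + m * k < N}"
    hence "m * k \<le> N" by simp
    hence "k \<le> ?q" using assms by (simp add: less_eq_div_iff_mult_less_eq mult.commute)
    thus "k \<in> {..?q}" by simp
  qed
  ultimately have "card {..<?q} \<le> card ?A" "card ?A \<le> card {..?q}"
    unfolding card using finite_subset[OF sub] by (blast intro: card_mono)+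
  hence c: "real ?q \<le> real (card ?A)" "real (card ?A) \<le> real ?q + 1" by auto
  have "real N = real m * real ?q + real (N mod m)"
    using N(1) by (metis of_nat_add of_nat_mult)
  hence "real N / real m = real ?q + real (N mod m) / real m"
    using assms by (simp add: field_simps)
  moreover have "0 \<le> real (N mod m) / real m" "real (N mod m) / real m \<le> 1"
    using N(2) by (auto simp: field_simps)
  ultimately show ?thesis using c by linarith
qed

text \<open>Induction over \<open>T\<close> with the modulus and the class left general. By the
  Chinese remainder theorem each class in \<open>\<Omega> p\<close> merges with \<open>a\<close>
  modulo \<open>m\<close> into a single class modulo \<open>m * p\<close>; these classes are
  disjoint, so the errors add up to a factor \<open>card (\<Omega> p)\<close>.\<close>

lemma card_sifted_residue_class:
  fixes T :: "nat set" and \<Omega> :: "nat \<Rightarrow> nat set"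
  assumes "finite T" "\<And>p. p \<in> T \<Longrightarrow> prime p" "\<And>p. p \<in> T \<Longrightarrow> \<Omega> p \<subseteq> {..<p}"
    and "m > 0" "\<And>p. p \<in> T \<Longrightarrow> coprime m p"
  shows "\<bar>real (card {n. n < N \<and> [n = a] (mod m) \<and> (\<forall>p\<in>T. n mod p \<in> \<Omega> p)}) -
     real N / real m * (\<Prod>p\<in>T. real (card (\<Omega> p)) / real p)\<bar> \<le> (\<Prod>p\<in>T. real (card (\<Omega> p)))"
  using assms
proof (induction T arbitrary: m a rule: finite_induct)
  case empty
  thus ?case using card_residue_class[of m N a] by simp
next
  case (insert p T)
  have p: "prime p" and pp: "p > 0" and cmp: "coprime m p" and sub: "\<Omega> p \<subseteq> {..<p}" 
    using insert.prems by (auto simp: prime_gt_0_nat)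
  have fin: "finite (\<Omega> p)" using sub finite_subset by blast
  have "\<exists>c. [c = a] (mod m) \<and> [c = b] (mod p)" for b
    using binary_chinese_remainder_nat[OF cmp] by blast
  then obtain c where c: "\<And>b. [c b = a] (mod m)" "\<And>b. [c b = b] (mod p)" by metis
  let ?B = "\<lambda>b. {n. n < N \<and> [n = c b] (mod (m * p)) \<and> (\<forall>q\<in>T. n mod q \<in> \<Omega> q)}"
  have cong: "[n = c b] (mod (m * p)) \<longleftrightarrow> [n = a] (mod m) \<and> n mod p = b" if "b \<in> \<Omega> p" for n b
  proof -
    have "b < p" using sub that by auto
    have "[n = c b] (mod (m * p)) \<longleftrightarrow> [n = c b] (mod m) \<and> [n = c b] (mod p)"
      using cmp by (meson coprime_cong_mult_nat cong_modulus_mult_nat cong_modulus_mult_nat mult.commute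
          cong_dvd_modulus_nat dvd_triv_left dvd_triv_right)
    also have "\<dots> \<longleftrightarrow> [n = a] (mod m) \<and> [n = b] (mod p)"
      using c cong_trans cong_sym by blast
    finally show ?thesis using \<open>b < p\<close> by (simp add: unique_euclidean_semiring_class.cong_def)
  qed
  have "{n. n < N \<and> [n = a] (mod m) \<and> (\<forall>q\<in>insert p T. n mod q \<in> \<Omega> q)} = (\<Union>b\<in>\<Omega> p. ?B b)"
    using cong by auto
  moreover have "card (\<Union>b\<in>\<Omega> p. ?B b) = (\<Sum>b\<in>\<Omega> p. card (?B b))"
    by (rule card_UN_disjoint) (use fin cong in auto)
  ultimately have card: "card {n. n < N \<and> [n = a] (mod m) \<and> (\<forall>q\<in>insert p T. n mod q \<in> \<Omega> q)} = 
    (\<Sum>b\<in>\<Omega> p. card (?B b))" by simp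
  let ?x = "real N / real (m * p) * (\<Prod>q\<in>T. real (card (\<Omega> q)) / real q)"
  let ?y = "\<Prod>q\<in>T. real (card (\<Omega> q))"
  have "\<bar>real (card (?B b)) - ?x\<bar> \<le> ?y" for b
  proof (rule insert.IH)
    fix q assume "q \<in> T"
    hence "prime q" "q \<noteq> p" "coprime m q" using insert by auto
    thus "coprime (m * p) q" using p by (simp add: primes_coprime)
  qed (use insert.prems pp in auto)
  hence "\<bar>\<Sum>b\<in>\<Omega> p. (real (card (?B b)) - ?x)\<bar> \<le> (\<Sum>b\<in>\<Omega> p. ?y)"
    by (intro order.trans[OF sum_abs] sum_mono)
  hence "\<bar>(\<Sum>b\<in>\<Omega> p. real (card (?B b))) - real (card (\<Omega> p)) * ?x\<bar> \<le> real (card (\<Omega> p)) * ?y"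
    by (simp add: sum_subtractf)
  moreover have "real (card (\<Omega> p)) * ?x = real N / real m * (\<Prod>q\<in>insert p T. real (card (\<Omega> q)) / real q)"
    using insert.hyps by simp
  moreover have "(\<Prod>q\<in>insert p T. real (card (\<Omega> q))) = real (card (\<Omega> p)) * ?y"
    using insert.hyps by simp
  ultimately show ?case unfolding card of_nat_sum by simp
qed

section \<open>Roots of linear forms modulo a prime\<close>

lemma linear_congruence_unique_root:
  fixes A B :: int and l :: nat
  assumes "prime l" "\<not> int l dvd A"
  shows "\<exists>!b. b < l \<and> int l dvd A * int b + B"
proof -
  have cop: "coprime A (int l)"
    using assms prime_imp_coprime[of "int l" A] by (simp add: coprime_commute)
  have l: "l > 0" using assms prime_gt_0_nat by blast
  obtain x where x: "[A * x = - B] (mod int l)" 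
    using cong_solve_coprime_int[OF cop] cong_scalar_right[of "A * _" 1 "int l" "-B"]
    by (metis mult.assoc mult_1)
  define b where "b = nat (x mod int l)"
  have b: "int b = x mod int l" using l by (simp add: b_def)
  have "[int b = x] (mod int l)" unfolding b by simp
  hence "[A * int b = - B] (mod int l)" using x cong_scalar_left cong_trans by blast
  hence b1: "int l dvd A * int b + B" by (simp add: cong_iff_dvd_diff)
  have "int b < int l" unfolding b using l by simp
  moreover have "b' = b''" if "b' < l" "b'' < l" "int l dvd A * int b' + B" "int l dvd A * int b'' + B" for b' b''
  proof -
    have "int l dvd A * (int b' - int b'')" using dvd_diff[OF that(3,4)] by (simp add: algebra_simps)
    hence "int l dvd int b' - int b''"
      using cop coprime_dvd_mult_right_iff coprime_commute by blast
    hence "[int b' = int b''] (mod int l)" by (simp add: cong_iff_dvd_diff)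
    hence "[b' = b''] (mod l)" by (simp add: cong_int_iff)
    thus ?thesis using that by (simp add: unique_euclidean_semiring_class.cong_def)
  qed
  ultimately show ?thesis using b1 by (intro ex1I[of _ b]) auto
qed

lemma card_linear_root:
  fixes A B :: int and l :: nat
  assumes "prime l" "\<not> int l dvd A"
  shows "card {b. b < l \<and> int l dvd A * int b + B} = 1"
proof -
  obtain r where "\<And>b. b < l \<and> int l dvd A * int b + B \<longleftrightarrow> b = r"
    using linear_congruence_unique_root[OF assms, of B] by blast
  thus ?thesis by simp
qed

text \<open>Each form has exactly one root modulo \<open>l\<close>, and a common root of two forms
  would make \<open>l\<close> divide their determinant, so the three roots are distinct.\<close>

lemma card_roots_three_linear:
  fixes A1 B1 A2 B2 A3 B3 :: int and l :: nat
  assumes l: "prime l" and A: "\<not> int l dvd A1" "\<not> int l dvd A2" "\<not> int l dvd A3"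
    and det: "\<not> int l dvd A1 * B2 - A2 * B1" "\<not> int l dvd A1 * B3 - A3 * B1" "\<not> int l dvd A2 * B3 - A3 * B2"
  shows "card {b. b < l \<and> (int l dvd A1 * int b + B1 \<or> int l dvd A2 * int b + B2 \<or> int l dvd A3 * int b + B3)} = 3"
proof -
  obtain r1 where r1: "\<And>b. b < l \<and> int l dvd A1 * int b + B1 \<longleftrightarrow> b = r1"
    using linear_congruence_unique_root[OF l A(1), of B1] by blast
  obtain r2 where r2: "\<And>b. b < l \<and> int l dvd A2 * int b + B2 \<longleftrightarrow> b = r2"
    using linear_congruence_unique_root[OF l A(2), of B2] by blast
  obtain r3 where r3: "\<And>b. b < l \<and> int l dvd A3 * int b + B3 \<longleftrightarrow> b = r3"
    using linear_congruence_unique_root[OF l A(3), of B3] by blast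
  have distinct: "\<not> (int l dvd A * int b + B \<and> int l dvd A' * int b + B')" if "\<not> int l dvd A * B' - A' * B" for A B A' B' b
  proof
    assume *: "int l dvd A * int b + B \<and> int l dvd A' * int b + B'"
    have "int l dvd A * (A' * int b + B') - A' * (A * int b + B)"
      by (rule dvd_diff; rule dvd_mult) (use * in auto)
    also have "A * (A' * int b + B') - A' * (A * int b + B) = A * B' - A' * B" by (simp add: algebra_simps)
    finally show False using that by simp
  qed
  have "r1 \<noteq> r2" "r1 \<noteq> r3" "r2 \<noteq> r3"
    using distinct[OF det(1)] distinct[OF det(2)] distinct[OF det(3)] r1 r2 r3 by blast+
  moreover have "{b. b < l \<and> (int l dvd A1 * int b + B1 \<or> int l dvd A2 * int b + B2 \<or> int l dvd A3 * int b + B3)} = {r1, r2, r3}"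
    using r1 r2 r3 by blast
  ultimately show ?thesis by simp
qed

text \<open>The number of residue classes that are excluded modulo the prime \<open>p\<close>.\<close>

definition om :: "nat \<Rightarrow> nat" where
  "om p = (if p < 5 then 1 else 3)"

definition rho :: "nat \<Rightarrow> real" where
  "rho p = real (om p) / real p"

text \<open>The squarefree numbers up to \<open>z\<close>, as sets of primes. The bound on the
  single primes keeps \<open>T\<close> finite: the product over an infinite set is 1 by convention
  and would pass the bound on the product.\<close>

definition sieve_support :: "real \<Rightarrow> nat set set" where
  "sieve_support z = {T. T \<subseteq> {p. prime p \<and> real p \<le> z} \<and> real (\<Prod>T) \<le> z}"

definition sieve_sum :: "real \<Rightarrow> real" where
  "sieve_sum z = (\<Sum>T\<in>sieve_support z. \<Prod>p\<in>T. rho p / (1 - rho p))"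

text \<open>The 9 is \<open>3 * 3\<close>: one factor 3 per prime from the size of the weights,
  since \<open>1 / (1 - rho p) \<le> 5 / 2\<close>, and one from the number of excluded
  classes.\<close>

definition sieve_error :: "real \<Rightarrow> real" where
  "sieve_error z = (\<Sum>T\<in>sieve_support z. 9 ^ card T)\<^sup>2"

lemma rho_pos: "prime p \<Longrightarrow> rho p > 0"
  using prime_gt_0_nat[of p] by (simp add: rho_def om_def)

text \<open>The largest density occurs at \<open>p = 5\<close>; the values at 2 and 3 are
  \<open>1 / 2\<close> and \<open>1 / 3\<close>.\<close>

lemma rho_le: 
  assumes "prime p" shows "rho p \<le> 3 / 5"
proof (cases "p < 5")
  case True
  hence "p = 2 \<or> p = 3 \<or> p = 4" using prime_ge_2_nat[OF assms] by auto
  thus ?thesis using assms by (auto simp: rho_def om_def)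
next
  case False
  thus ?thesis by (simp add: rho_def om_def field_simps)
qed

lemma finite_primes_le_real: "finite {p::nat. prime p \<and> real p \<le> z}"
  by (rule finite_subset[of _ "{..nat \<lfloor>z\<rfloor>}"]) (auto simp: le_nat_floor)

lemma sieve_support_selberg:
  assumes "z \<ge> 1"
  shows "selberg_sieve {p. prime p \<and> real p \<le> z} (sieve_support z) rho"
proof
  show "K \<in> sieve_support z" if T: "T \<in> sieve_support z" and K: "K \<subseteq> T" for T K
  proof -
    have T': "T \<subseteq> {p. prime p \<and> real p \<le> z}" "real (\<Prod>T) \<le> z" using T by (auto simp: sieve_support_def)
    hence "finite T" using finite_primes_le_real finite_subset by blast
    hence "\<Prod>T = \<Prod>K * \<Prod>(T - K)" using K by (metis mult.commute prod.subset_diff)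
    moreover have "\<Prod>(T - K) \<ge> 1"
      using T' prime_ge_1_nat by (intro prod_ge_1) auto
    ultimately have "\<Prod>K \<le> \<Prod>T" by simp
    hence "real (\<Prod>K) \<le> z" using T' by linarith
    thus ?thesis using K T' by (auto simp: sieve_support_def)
  qed
  show "rho p < 1" if "p \<in> {p. prime p \<and> real p \<le> z}" for p
    using that rho_le[of p] by simp
qed (use assms rho_pos finite_primes_le_real in \<open>auto simp: sieve_support_def\<close>)

lemma finite_sieve_support: "finite (sieve_support z)"
  by (rule finite_subset[of _ "Pow {p. prime p \<and> real p \<le> z}"])
     (use finite_primes_le_real in \<open>auto simp: sieve_support_def\<close>)

lemma sieve_sum_ge_1: "z \<ge> 1 \<Longrightarrow> sieve_sum z \<ge> 1"
  using selberg_sieve.S_ge_1[OF sieve_support_selberg]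
  by (simp add: sieve_sum_def selberg_sieve.S_def[OF sieve_support_selberg]
    selberg_sieve.G_def[OF sieve_support_selberg])

lemma sieve_error_nonneg: "sieve_error z \<ge> 0"
  by (simp add: sieve_error_def)

text \<open>Selberg's bound with the discrepancy of \<open>card_sifted_residue_class\<close> for
  modulus 1. The main term depends on the \<open>\<Omega> l\<close> only through their
  cardinalities. Since \<open>card (T1 \<union> T2) \<le> card T1 + card T2\<close>, the double
  error sum is bounded by a square.\<close>

theorem sieve_upper_bound:
  fixes \<Omega> :: "nat \<Rightarrow> nat set"
  assumes z: "z \<ge> 1"
    and \<Omega>: "\<And>l. prime l \<Longrightarrow> \<Omega> l \<subseteq> {..<l}" "\<And>l. prime l \<Longrightarrow> card (\<Omega> l) = om l"
  shows "real (card {t. t < N \<and> (\<forall>l. prime l \<and> real l \<le> z \<longrightarrow> t mod l \<notin> \<Omega> l)}) \<le>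
    real N / sieve_sum z + sieve_error z"
proof -
  let ?P = "{p. prime p \<and> real p \<le> z}"
  interpret selberg_sieve ?P "sieve_support z" rho by (rule sieve_support_selberg[OF z])
  have S: "S = sieve_sum z" by (simp add: S_def G_def sieve_sum_def)
  have R: "(\<Prod>p\<in>T. real (om p)) \<le> 3 ^ card T" for T
    using prod_mono[of T "\<lambda>p. real (om p)" "\<lambda>_. 3"] by (simp add: om_def)
  have w: "\<bar>weight T\<bar> \<le> 3 ^ card T" if T: "T \<in> sieve_support z" for T
  proof -
    have "(\<Prod>p\<in>T. 1 / (1 - rho p)) \<le> (\<Prod>p\<in>T. 3)"
    proof (rule prod_mono)
      fix p assume "p \<in> T"
      hence "prime p" using T by (auto simp: sieve_support_def)
      from rho_le[OF this] show "0 \<le> 1 / (1 - rho p) \<and> 1 / (1 - rho p) \<le> 3" by (simp add: field_simps)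
    qed
    thus ?thesis using abs_weight_le[OF T] by simp
  qed
  have dist: "\<bar>real (card {n \<in> {..<N}. \<forall>p\<in>T. n mod p \<in> \<Omega> p}) - real N * (\<Prod>p\<in>T. rho p)\<bar> \<le> (\<Prod>p\<in>T. real (om p))"
    if T: "T \<subseteq> ?P" for T
  proof -
    have fin: "finite T" using T finite_primes_le_real finite_subset by blast
    have "\<bar>real (card {n. n < N \<and> [n = 0] (mod 1) \<and> (\<forall>p\<in>T. n mod p \<in> \<Omega> p)}) -
     real N / real 1 * (\<Prod>p\<in>T. real (card (\<Omega> p)) / real p)\<bar> \<le> (\<Prod>p\<in>T. real (card (\<Omega> p)))"
      by (rule card_sifted_residue_class) (use T \<Omega> fin in auto)
    moreover have "(\<Prod>p\<in>T. real (card (\<Omega> p)) / real p) = (\<Prod>p\<in>T. rho p)"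
      "(\<Prod>p\<in>T. real (card (\<Omega> p))) = (\<Prod>p\<in>T. real (om p))"
      using T \<Omega> by (auto intro!: prod.cong simp: rho_def)
    moreover have "{n. n < N \<and> [n = 0] (mod 1) \<and> (\<forall>p\<in>T. n mod p \<in> \<Omega> p)} = {n \<in> {..<N}. \<forall>p\<in>T. n mod p \<in> \<Omega> p}"
      by auto
    ultimately show ?thesis by (simp only: of_nat_1 div_by_1)
  qed
  have "real (card {n \<in> {..<N}. \<forall>p\<in>?P. n mod p \<notin> \<Omega> p}) \<le> real N / S +
    (\<Sum>T1\<in>sieve_support z. \<Sum>T2\<in>sieve_support z. \<bar>weight T1\<bar> * \<bar>weight T2\<bar> * (\<Prod>p\<in>T1 \<union> T2. real (om p)))"
    by (rule selberg_upper_bound) (use dist in auto)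
  also have "(\<Sum>T1\<in>sieve_support z. \<Sum>T2\<in>sieve_support z. \<bar>weight T1\<bar> * \<bar>weight T2\<bar> * (\<Prod>p\<in>T1 \<union> T2. real (om p)))
    \<le> (\<Sum>T1\<in>sieve_support z. \<Sum>T2\<in>sieve_support z. 9 ^ card T1 * 9 ^ card T2)"
  proof (intro sum_mono)
    fix T1 T2 assume T: "T1 \<in> sieve_support z" "T2 \<in> sieve_support z"
    have "(\<Prod>p\<in>T1 \<union> T2. real (om p)) \<le> 3 ^ card (T1 \<union> T2)" by (rule R)
    also have "\<dots> \<le> 3 ^ (card T1 + card T2)" by (intro power_increasing card_Un_le) auto
    also have "\<dots> = 3 ^ card T1 * 3 ^ card T2" by (rule power_add)
    finally have "\<bar>weight T1\<bar> * \<bar>weight T2\<bar> * (\<Prod>p\<in>T1 \<union> T2. real (om p)) \<le>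
      (3 ^ card T1 * 3 ^ card T2) * (3 ^ card T1 * 3 ^ card T2)"
      by (intro mult_mono w T) (auto intro: prod_nonneg)
    also have "\<dots> = (3 * 3) ^ card T1 * (3 * 3) ^ card T2" by (simp only: power_mult_distrib mult_ac)
    finally show "\<bar>weight T1\<bar> * \<bar>weight T2\<bar> * (\<Prod>p\<in>T1 \<union> T2. real (om p)) \<le> 9 ^ card T1 * 9 ^ card T2"
      by simp
  qed
  also have "\<dots> = sieve_error z" by (simp add: sieve_error_def power2_eq_square sum_product)
  also have "{n \<in> {..<N}. \<forall>p\<in>?P. n mod p \<notin> \<Omega> p} = 
     {t. t < N \<and> (\<forall>l. prime l \<and> real l \<le> z \<longrightarrow> t mod l \<notin> \<Omega> l)}" by auto
  finally show ?thesis unfolding S by simp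
qed

section \<open>Prime triples on a progression\<close>

lemma int_dvd_linear_mod:
  fixes A B :: int and t l :: nat
  shows "int l dvd A * int (t mod l) + B \<longleftrightarrow> int l dvd A * int t + B"
proof -
  have "[int (t mod l) = int t] (mod int l)" by (simp add: of_nat_mod)
  hence "[A * int (t mod l) + B = A * int t + B] (mod int l)"
    by (intro cong_add cong_scalar_left cong_refl)
  thus ?thesis by (rule cong_dvd_iff)
qed

lemma card_image_le_real:
  assumes "A \<subseteq> f ` {..nat \<lfloor>z\<rfloor>}" "z \<ge> 0"
  shows "finite A \<and> real (card A) \<le> z + 1"
proof -
  have "card A \<le> card (f ` {..nat \<lfloor>z\<rfloor>})" by (rule card_mono) (use assms in auto)
  also have "\<dots> \<le> card {..nat \<lfloor>z\<rfloor>}" by (rule card_image_le) simp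
  finally have "real (card A) \<le> real (nat \<lfloor>z\<rfloor>) + 1" by simp
  also have "real (nat \<lfloor>z\<rfloor>) \<le> z" using assms by simp
  finally show ?thesis using finite_subset[OF assms(1)] by simp
qed

lemma det_first_third: "b * (2 * a * q - 1) - (2 * a * b) * q = - b" for a b q :: int
  by (simp add: algebra_simps)

lemma det_second_third:
  fixes a b c q :: int
  assumes "a * q - 1 = b * c"
  shows "a * (2 * a * q - 1) - (2 * a * b) * c = a"
proof -
  have "a * (2 * a * q - 1) - (2 * a * b) * c = 2 * a * (a * q - b * c) - a"
    by (simp add: algebra_simps)
  also have "a * q - b * c = 1" using assms by simp
  finally show ?thesis by simp
qed

text \<open>Here \<open>q = q0 + b t\<close>, \<open>r = c + a t\<close> and \<open>p = 2 a q - 1\<close>, where \<open>a q0 - b c = 1\<close>; the pairwise determinants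
  of the three forms are \<open>-1\<close>, \<open>-b\<close> and \<open>a\<close>.  The three terms \<open>z + 1\<close> account for \<open>q\<close>, \<open>r\<close> or \<open>p\<close> up to \<open>z\<close>.\<close>

theorem card_prime_triples_le:
  fixes a b :: nat and Y z :: real
  assumes ab: "a > 0" "b > 0" "coprime a b" and small: "\<And>l. prime l \<Longrightarrow> l dvd a * b \<Longrightarrow> l < 5"
    and z: "z \<ge> 1" and Y: "Y \<ge> 0"
  defines "C \<equiv> {q. prime q \<and> prime (2 * a * q - 1) \<and> (\<exists>r. prime r \<and> a * q = b * r + 1) \<and> real q \<le> Y}"
  shows "real (card C) \<le> (Y / real b + 1) / sieve_sum z + sieve_error z + 3 * (z + 1)"
proof (cases "C = {}")
  case True
  thus ?thesis using sieve_sum_ge_1[OF z] sieve_error_nonneg[of z] z Y ab by simp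
next
  case False
  then obtain q1 where q1: "q1 \<in> C" by blast
  \<comment> \<open>As \<open>a\<close> is invertible modulo \<open>b\<close>, the equation
    \<open>a * q = b * r + 1\<close> fixes the class of \<open>q\<close> modulo \<open>b\<close>;
    any member of \<open>C\<close> reveals it.\<close>
  define q0 where "q0 = q1 mod b"
  have cong1: "[a * q = 1] (mod b)" if "q \<in> C" for q
  proof -
    obtain r where "a * q = b * r + 1" using \<open>q \<in> C\<close> by (auto simp: C_def)
    thus ?thesis by (simp only: unique_euclidean_semiring_class.cong_def mod_mult_self4)
  qed
  have q0: "q mod b = q0" if "q \<in> C" for q
  proof -
    have "[a * q = a * q1] (mod b)" by (rule cong_trans[OF cong1[OF that] cong_sym[OF cong1[OF q1]]])
    hence "[q = q1] (mod b)" using ab by (simp add: cong_mult_lcancel_nat)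
    thus ?thesis by (simp add: q0_def unique_euclidean_semiring_class.cong_def)
  qed
  have "[a * q0 = a * q1] (mod b)" unfolding q0_def by (intro cong_scalar_left) simp
  hence "[a * q0 = 1] (mod b)" using cong_trans[OF _ cong1[OF q1]] by simp
  \<comment> \<open>The constant term \<open>c\<close> must be an integer: for \<open>b = 1\<close>
    one has \<open>q0 = 0\<close> and \<open>c = -1\<close>.\<close>
  hence "[int (a * q0) = int 1] (mod int b)" by (simp only: cong_int_iff)
  hence "int b dvd int (a * q0) - 1" by (simp add: cong_iff_dvd_diff)
  then obtain c where c: "int a * int q0 - 1 = int b * c" by auto
  let ?f1 = "\<lambda>t::nat. int b * int t + int q0"
  let ?f2 = "\<lambda>t::nat. int a * int t + c"
  let ?f3 = "\<lambda>t::nat. (2 * int a * int b) * int t + (2 * int a * int q0 - 1)"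
  \<comment> \<open>For \<open>l = 2\<close> and \<open>l = 3\<close> a single form is sieved,
    chosen so that its leading coefficient is prime to \<open>l\<close>: if \<open>l\<close> divides
    \<open>b\<close> it does not divide \<open>a\<close>, so \<open>?f2\<close> serves, and
    otherwise \<open>?f1\<close>. This makes the number of excluded classes the same for every pair
    \<open>(a, b)\<close>.\<close>
  define \<Omega> where "\<Omega> l = (if l < 5 then (if int l dvd int b then {t. t < l \<and> int l dvd ?f2 t} 
        else {t. t < l \<and> int l dvd ?f1 t})
     else {t. t < l \<and> (int l dvd ?f1 t \<or> int l dvd ?f2 t \<or> int l dvd ?f3 t)})" for l
  have \<Omega>_sub: "\<Omega> l \<subseteq> {..<l}" for l by (auto simp: \<Omega>_def)
  have \<Omega>_card: "card (\<Omega> l) = om l" if l: "prime l" for l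
  proof (cases "l < 5")
    case True
    show ?thesis
    proof (cases "int l dvd int b")
      case True
      hence "\<not> l dvd a" using ab l by (metis coprime_common_divisor int_dvd_int_iff not_prime_unit)
      hence "\<not> int l dvd int a" by simp
      from card_linear_root[OF l this, of c] show ?thesis
        using True \<open>l < 5\<close> by (simp add: \<Omega>_def om_def)
    next
      case False
      from card_linear_root[OF l this, of "int q0"] show ?thesis
        using False \<open>l < 5\<close> by (simp add: \<Omega>_def om_def)
    qed
  next
    case False
    hence "\<not> l dvd a * b" using small l by blast
    hence nd: "\<not> int l dvd int a" "\<not> int l dvd int b" by auto
    have lp: "prime (int l)" using l by simp
    have n2: "\<not> int l dvd 2" using False zdvd_imp_le[of "int l" 2] by auto
    have "\<not> int l dvd 2 * int a * int b" using nd n2 lp by (simp add: prime_dvd_mult_iff)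
    moreover have "int b * c - int a * int q0 = -1" using c by simp
    hence "\<not> int l dvd int b * c - int a * int q0"
      using False by (simp only: dvd_minus_iff zdvd1_eq)
    moreover have "\<not> int l dvd int b * (2 * int a * int q0 - 1) - (2 * int a * int b) * int q0"
      unfolding det_first_third dvd_minus_iff by (rule nd(2))
    moreover have "\<not> int l dvd int a * (2 * int a * int q0 - 1) - (2 * int a * int b) * c"
      unfolding det_second_third[OF c] by (rule nd(1))
    ultimately have "card {t. t < l \<and> (int l dvd ?f1 t \<or> int l dvd ?f2 t \<or> int l dvd ?f3 t)} = 3"
      by (intro card_roots_three_linear l nd)
    thus ?thesis using False by (simp add: \<Omega>_def om_def)
  qed
  \<comment> \<open>The parameter \<open>t\<close> runs from 0 up to and including the floor of
    \<open>Y / b\<close>, hence the \<open>+ 1\<close>.\<close>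
  define N where "N = nat \<lfloor>Y / real b\<rfloor> + 1"
  define U where "U = {t. t < N \<and> (\<forall>l. prime l \<and> real l \<le> z \<longrightarrow> t mod l \<notin> \<Omega> l)}"
  define C1 where "C1 = {q \<in> C. real q \<le> z}"
  define C2 where "C2 = {q \<in> C. \<exists>r. a * q = b * r + 1 \<and> real r \<le> z}"
  define C3 where "C3 = {q \<in> C. real (2 * a * q - 1) \<le> z}"
  have sub: "C \<subseteq> C1 \<union> C2 \<union> C3 \<union> (\<lambda>t. q0 + b * t) ` U"
  proof
    fix q assume q: "q \<in> C"
    show "q \<in> C1 \<union> C2 \<union> C3 \<union> (\<lambda>t. q0 + b * t) ` U"
    proof (rule ccontr)
      assume neg: "q \<notin> C1 \<union> C2 \<union> C3 \<union> (\<lambda>t. q0 + b * t) ` U"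
      obtain r where r: "prime r" "a * q = b * r + 1" using q by (auto simp: C_def)
      have pq: "prime q" and pp: "prime (2 * a * q - 1)" and qY: "real q \<le> Y" using q by (auto simp: C_def)
      have big: "real q > z" "real r > z" "real (2 * a * q - 1) > z"
        using neg q r by (auto simp: C1_def C2_def C3_def not_le)
      define t where "t = q div b"
      have qt: "q = q0 + b * t" unfolding t_def q0[OF q, symmetric] by simp
      have f1: "?f1 t = int q" by (simp add: qt)
      have f3: "?f3 t = int (2 * a * q - 1)"
      proof -
        have "2 * a * q \<ge> 1" using ab prime_gt_0_nat[OF pq] by simp
        hence "int (2 * a * q - 1) = 2 * int a * int q - 1" by (simp add: of_nat_diff)
        thus ?thesis by (simp add: qt algebra_simps)
      qed
      \<comment> \<open>The value \<open>r\<close> is identified after multiplication by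
        \<open>b\<close>, where both sides equal \<open>a * q - 1\<close>.\<close>
      have "int b * ?f2 t = int b * int r"
      proof -
        have "int b * ?f2 t = int a * (int b * int t) + int b * c" by (simp add: algebra_simps)
        also have "\<dots> = int a * (int q0 + int b * int t) - 1" unfolding c[symmetric] by (simp add: algebra_simps)
        also have "\<dots> = int (a * q) - 1" by (simp add: qt)
        finally show ?thesis by (simp add: r)
      qed
      hence f2: "?f2 t = int r" using ab by simp
      have "t mod l \<notin> \<Omega> l" if l: "prime l" "real l \<le> z" for l
      proof
        assume "t mod l \<in> \<Omega> l"
        hence "int l dvd ?f1 (t mod l) \<or> int l dvd ?f2 (t mod l) \<or> int l dvd ?f3 (t mod l)"
          by (auto simp: \<Omega>_def split: if_splits)
        hence "int l dvd ?f1 t \<or> int l dvd ?f2 t \<or> int l dvd ?f3 t"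
          unfolding int_dvd_linear_mod .
        hence "l dvd q \<or> l dvd r \<or> l dvd (2 * a * q - 1)"
          unfolding f1 f2 f3 int_dvd_int_iff .
        hence "l = q \<or> l = r \<or> l = 2 * a * q - 1"
          using pq pp r l primes_dvd_imp_eq by blast
        thus False using l big by auto
      qed
      moreover have "t < N"
      proof -
        have "real b * real t \<le> Y" using qY by (simp add: qt)
        hence "real t \<le> Y / real b" using ab by (simp add: field_simps)
        hence "t \<le> nat \<lfloor>Y / real b\<rfloor>" by (rule le_nat_floor)
        thus ?thesis by (simp add: N_def)
      qed
      ultimately have "t \<in> U" by (simp add: U_def)
      thus False using neg qt by blast
    qed
  qed
  have "C1 \<subseteq> (\<lambda>q. q) ` {..nat \<lfloor>z\<rfloor>}" by (auto simp: C1_def le_nat_floor)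
  note C1 = card_image_le_real[OF this]
  have "C2 \<subseteq> (\<lambda>r. (b * r + 1) div a) ` {..nat \<lfloor>z\<rfloor>}"
  proof
    fix q assume "q \<in> C2"
    then obtain r where r: "a * q = b * r + 1" "real r \<le> z" by (auto simp: C2_def)
    have "q = (b * r + 1) div a" unfolding r(1)[symmetric] using ab by simp
    thus "q \<in> (\<lambda>r. (b * r + 1) div a) ` {..nat \<lfloor>z\<rfloor>}" using r le_nat_floor by blast
  qed
  note C2 = card_image_le_real[OF this]
  have "C3 \<subseteq> (\<lambda>p. (p + 1) div (2 * a)) ` {..nat \<lfloor>z\<rfloor>}"
  proof
    fix q assume q: "q \<in> C3"
    hence "q > 0" using prime_gt_0_nat by (auto simp: C3_def C_def)
    hence "q = (2 * a * q - 1 + 1) div (2 * a)" using ab by simp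
    moreover have "2 * a * q - 1 \<in> {..nat \<lfloor>z\<rfloor>}" using q by (auto simp: C3_def intro: le_nat_floor)
    ultimately show "q \<in> (\<lambda>p. (p + 1) div (2 * a)) ` {..nat \<lfloor>z\<rfloor>}" by blast
  qed
  note C3 = card_image_le_real[OF this]
  have finU: "finite U" unfolding U_def by simp
  have "card C \<le> card (C1 \<union> C2 \<union> C3 \<union> (\<lambda>t. q0 + b * t) ` U)"
    by (rule card_mono[OF _ sub]) (use C1 C2 C3 finU z in auto)
  also have "\<dots> \<le> card (C1 \<union> C2 \<union> C3) + card ((\<lambda>t. q0 + b * t) ` U)" by (rule card_Un_le)
  also have "\<dots> \<le> card (C1 \<union> C2) + card C3 + card U"
    by (intro add_mono card_Un_le card_image_le finU)
  also have "\<dots> \<le> card C1 + card C2 + card C3 + card U"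
    by (intro add_mono card_Un_le) auto
  finally have "real (card C) \<le> real (card C1) + real (card C2) + real (card C3) + real (card U)" by linarith
  also have "\<dots> \<le> (z + 1) + (z + 1) + (z + 1) + (real N / sieve_sum z + sieve_error z)"
    unfolding U_def by (intro add_mono sieve_upper_bound \<Omega>_sub \<Omega>_card z) (use C1 C2 C3 z in auto)
  also have "real N / sieve_sum z \<le> (Y / real b + 1) / sieve_sum z"
    using sieve_sum_ge_1[OF z] Y ab by (intro divide_right_mono) (auto simp: N_def)
  finally show ?thesis by simp
qed

section \<open>The main term of the sieve\<close>

lemma power_Suc_diff_le:
  fixes u v :: real
  assumes "0 \<le> v" "v \<le> u"
  shows "u ^ Suc k - v ^ Suc k \<le> real (Suc k) * ((u - v) * u ^ k)"
proof (induction k)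
  case (Suc k)
  have "u ^ Suc (Suc k) - v ^ Suc (Suc k) = u * (u ^ Suc k - v ^ Suc k) + (u - v) * v ^ Suc k"
    by (simp add: algebra_simps)
  also have "\<dots> \<le> u * (real (Suc k) * ((u - v) * u ^ k)) + (u - v) * u ^ Suc k"
    using assms Suc by (intro add_mono mult_left_mono power_mono) auto
  also have "\<dots> = real (Suc (Suc k)) * ((u - v) * u ^ Suc k)"
    by (simp add: algebra_simps)
  finally show ?case .
qed simp

definition log_kernel :: "nat \<Rightarrow> real \<Rightarrow> real \<Rightarrow> real" where
  "log_kernel k y t = (if t \<le> y then ln (y / t) ^ k / t else 0)"

text \<open>For \<open>t < y\<close> the derivative in \<open>t\<close> is
  \<open>- log_kernel k y t\<close>; the maximum continues the function by zero beyond
  \<open>y\<close>.\<close>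

definition log_primitive :: "nat \<Rightarrow> real \<Rightarrow> real \<Rightarrow> real" where
  "log_primitive k y t = max 0 (ln (y / t)) ^ Suc k / real (Suc k)"

lemma log_kernel_nonneg: "0 < t \<Longrightarrow> 0 \<le> log_kernel k y t"
  by (auto simp: log_kernel_def field_simps)

lemma log_kernel_antimono:
  assumes "0 < s" "s \<le> t"
  shows "log_kernel k y t \<le> log_kernel k y s"
proof (cases "t \<le> y")
  case True
  have "y > 0" "s \<le> y" using assms True by auto
  have "ln (y / t) \<le> ln (y / s)" using assms \<open>y > 0\<close> by (simp add: frac_le)
  moreover have "0 \<le> ln (y / t)" using assms True by simp
  ultimately have "ln (y / t) ^ k / t \<le> ln (y / s) ^ k / s"
    using assms by (intro frac_le power_mono) auto
  thus ?thesis using True \<open>s \<le> y\<close> by (simp add: log_kernel_def)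
next
  case False
  thus ?thesis using log_kernel_nonneg[OF assms(1), of k y] by (simp add: log_kernel_def)
qed

text \<open>The left side is the integral of the decreasing kernel from \<open>s\<close> to
  \<open>t\<close>, at most the length times the value at \<open>s\<close>. The proof avoids
  integrals: it uses the mean value bound for powers and
  \<open>ln (t / s) \<le> t / s - 1\<close>.\<close>

lemma log_primitive_diff_le:
  assumes "0 < y" "0 < s" "s \<le> t"
  shows "log_primitive k y s - log_primitive k y t \<le> (t - s) * log_kernel k y s"
proof (cases "s \<le> y")
  case True
  define u where "u = ln (y / s)"
  define v where "v = max 0 (ln (y / t))"
  have u: "u \<ge> 0" using True assms by (simp add: u_def)
  have "ln (y / t) \<le> u" using assms unfolding u_def by (simp add: frac_le)
  hence v: "0 \<le> v" "v \<le> u" using u by (auto simp: v_def)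
  have "u - v \<le> u - ln (y / t)" by (simp add: v_def)
  also have "\<dots> = ln (t / s)" using assms by (simp add: u_def ln_div)
  also have "\<dots> \<le> t / s - 1" using assms by (intro ln_le_minus_one) simp
  finally have d: "u - v \<le> (t - s) / s" using assms by (simp add: field_simps)
  have "log_primitive k y s - log_primitive k y t = (u ^ Suc k - v ^ Suc k) / real (Suc k)"
    using u by (simp add: log_primitive_def u_def[symmetric] v_def[symmetric] diff_divide_distrib del: power_Suc)
  also have "\<dots> \<le> real (Suc k) * ((u - v) * u ^ k) / real (Suc k)"
    by (intro divide_right_mono power_Suc_diff_le v) simp
  also have "\<dots> = (u - v) * u ^ k" by (simp del: of_nat_Suc)
  also have "\<dots> \<le> (t - s) / s * u ^ k" using d u by (intro mult_right_mono) auto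
  also have "\<dots> = (t - s) * log_kernel k y s" using True by (simp add: log_kernel_def u_def)
  finally show ?thesis .
next
  case False
  have "ln (y / s) \<le> 0" "ln (y / t) \<le> 0" using False assms by auto
  hence "max 0 (ln (y / s)) = 0" "max 0 (ln (y / t)) = 0" by auto
  thus ?thesis using False by (simp add: log_primitive_def log_kernel_def)
qed

text \<open>Shifting by \<open>J * W\<close> preserves coprimality to \<open>W\<close> and carries
  the totatives of \<open>W\<close> onto the block, which is open on the left like their
  range.\<close>

lemma card_coprime_block:
  assumes "W > 0"
  shows "card {a \<in> {J * W<..Suc J * W}. coprime a W} = totient W"
proof -
  have cop: "coprime (J * W + k) W \<longleftrightarrow> coprime k W" for k
  proof -
    have "coprime (J * W + k) W \<longleftrightarrow> coprime ((J * W + k) mod W) W"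
      using assms by (simp only: coprime_mod_left_iff)
    also have "(J * W + k) mod W = k mod W" by simp
    finally show ?thesis using assms by (simp only: coprime_mod_left_iff)
  qed
  have "(\<lambda>k. J * W + k) ` totatives W = {a \<in> {J * W<..Suc J * W}. coprime a W}"
  proof (intro equalityI subsetI)
    fix a assume a: "a \<in> {a \<in> {J * W<..Suc J * W}. coprime a W}"
    hence eq: "a = J * W + (a - J * W)" by simp
    have "coprime (J * W + (a - J * W)) W" using a eq by simp
    hence "a - J * W \<in> totatives W" unfolding cop using a by (auto simp: in_totatives_iff)
    thus "a \<in> (\<lambda>k. J * W + k) ` totatives W" using eq by blast
  qed (auto simp: in_totatives_iff cop)
  moreover have "card ((\<lambda>k. J * W + k) ` totatives W) = card (totatives W)"
    by (rule card_image) (simp add: inj_on_def)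
  ultimately show ?thesis by (simp add: totient_def)
qed

text \<open>Each block of length \<open>W\<close> contains \<open>totient W\<close> integers coprime to \<open>W\<close>, at each of which the decreasing
  kernel is at least its value at the end of the block; this dominates the increment of the primitive over the
  following block, and the bound telescopes.\<close>

lemma sum_log_kernel_coprime_blocks:
  assumes "W > 0" "y > 0"
  shows "real (totient W) / real W * (log_primitive k y (real W) - log_primitive k y (real (Suc J * W)))
    \<le> (\<Sum>a\<in>{a \<in> {0<..J * W}. coprime a W}. log_kernel k y (real a))"
proof (induction J)
  case (Suc J)
  let ?B = "{a \<in> {J * W<..Suc J * W}. coprime a W}"
  have "{a \<in> {0<..M'}. coprime a W} = {a \<in> {0<..M}. coprime a W} \<union> {a \<in> {M<..M'}. coprime a W}"
    if "M \<le> M'" for M M' using that by auto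
  from this[of "J * W" "Suc J * W"]
  have "{a \<in> {0<..Suc J * W}. coprime a W} = {a \<in> {0<..J * W}. coprime a W} \<union> ?B" by simp
  moreover have "finite {a \<in> {0<..J * W}. coprime a W}" "finite ?B" by simp_all
  moreover have "{a \<in> {0<..M}. coprime a W} \<inter> {a \<in> {M<..M'}. coprime a W} = {}" for M M' by auto
  from this[of "J * W" "Suc J * W"]
  have "{a \<in> {0<..J * W}. coprime a W} \<inter> ?B = {}" .
  ultimately have split: "(\<Sum>a\<in>{a \<in> {0<..Suc J * W}. coprime a W}. log_kernel k y (real a)) =
    (\<Sum>a\<in>{a \<in> {0<..J * W}. coprime a W}. log_kernel k y (real a)) + (\<Sum>a\<in>?B. log_kernel k y (real a))"
    by (simp only: sum.union_disjoint)
  have "log_primitive k y (real (Suc J * W)) - log_primitive k y (real (Suc (Suc J) * W))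
      \<le> (real (Suc (Suc J) * W) - real (Suc J * W)) * log_kernel k y (real (Suc J * W))"
    using assms by (intro log_primitive_diff_le) (auto intro!: add_pos_nonneg)
  also have "real (Suc (Suc J) * W) - real (Suc J * W) = real W" by (simp add: algebra_simps)
  finally have "real (totient W) / real W * (log_primitive k y (real (Suc J * W)) - log_primitive k y (real (Suc (Suc J) * W)))
     \<le> real (totient W) / real W * (real W * log_kernel k y (real (Suc J * W)))"
    by (intro mult_left_mono) auto
  also have "\<dots> = (\<Sum>a\<in>?B. log_kernel k y (real (Suc J * W)))"
    using assms by (simp only: sum_constant card_coprime_block) simp
  also have "\<dots> \<le> (\<Sum>a\<in>?B. log_kernel k y (real a))"
    by (intro sum_mono log_kernel_antimono) (auto simp flip: of_nat_mult of_nat_add of_nat_Suc)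
  finally show ?case using Suc unfolding split by (simp only: right_diff_distrib)
qed simp

definition coprimes_upto :: "nat \<Rightarrow> real \<Rightarrow> nat set" where
  "coprimes_upto W y = {a. 0 < a \<and> coprime a W \<and> real a \<le> y}"

lemma finite_coprimes_upto [simp]: "finite (coprimes_upto W y)"
  by (rule finite_subset[of _ "{..nat \<lfloor>y\<rfloor>}"]) (auto simp: coprimes_upto_def le_nat_floor)

text \<open>The block estimate with \<open>J\<close> so large that all blocks together reach
  \<open>y\<close>: there the primitive at the far end is zero, and the terms beyond
  \<open>y\<close> vanish by the truncation of the kernel.\<close>

lemma sum_log_kernel_coprimes_ge:
  assumes "W > 0" "y > 0"
  shows "real (totient W) / real W * max 0 (ln (y / real W)) ^ Suc k / real (Suc k)
    \<le> (\<Sum>a\<in>coprimes_upto W y. log_kernel k y (real a))"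
proof -
  obtain J :: nat where J: "y \<le> real J" using real_arch_simple by blast
  have "J \<le> J * W" "J * W \<le> Suc J * W" using assms by auto
  hence "real J \<le> real (J * W)" "real J \<le> real (Suc J * W)" by (simp_all only: of_nat_le_iff)
  hence J': "y \<le> real (J * W)" "y \<le> real (Suc J * W)" using J by linarith+
  have "max 0 (ln (y / M)) = 0" if "y \<le> M" for M
    using assms that by (intro max_absorb1) simp
  from this[OF J'(2)] have "max 0 (ln (y / real (Suc J * W))) = 0" .
  hence z: "log_primitive k y (real (Suc J * W)) = 0" by (simp only: log_primitive_def) simp
  have "real (totient W) / real W * (log_primitive k y (real W) - log_primitive k y (real (Suc J * W)))
    \<le> (\<Sum>a\<in>{a \<in> {0<..J * W}. coprime a W}. log_kernel k y (real a))"
    by (rule sum_log_kernel_coprime_blocks[OF assms])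
  also have "\<dots> = (\<Sum>a\<in>coprimes_upto W y. log_kernel k y (real a))"
  proof (rule sum.mono_neutral_right)
    show "coprimes_upto W y \<subseteq> {a \<in> {0<..J * W}. coprime a W}"
    proof
      fix a assume a: "a \<in> coprimes_upto W y"
      hence "real a \<le> real (J * W)" using J' by (simp add: coprimes_upto_def)
      hence "a \<le> J * W" by (simp only: of_nat_le_iff)
      thus "a \<in> {a \<in> {0<..J * W}. coprime a W}" using a by (simp add: coprimes_upto_def)
    qed
  qed (auto simp: coprimes_upto_def log_kernel_def)
  finally show ?thesis unfolding z by (simp add: log_primitive_def)
qed

text \<open>For \<open>k \<ge> 1\<close> this is the sum of the reciprocals of the products over all
  \<open>k\<close>-tuples of positive integers coprime to \<open>W\<close> with product at most
  \<open>y\<close>.\<close>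

fun coprime_sum :: "nat \<Rightarrow> nat \<Rightarrow> real \<Rightarrow> real" where
  "coprime_sum W 0 y = 1"
| "coprime_sum W (Suc k) y = (\<Sum>a\<in>coprimes_upto W y. coprime_sum W k (y / real a) / real a)"

lemma coprime_sum_nonneg: "0 \<le> coprime_sum W k y"
  by (induction k arbitrary: y) (auto intro!: sum_nonneg divide_nonneg_nonneg)

text \<open>The bound for \<open>k\<close>, inserted at \<open>y / a\<close>, turns the outer sum
  into one over \<open>log_kernel k\<close>. Each level contributes the density of the integers
  coprime to \<open>W\<close> and costs a factor \<open>W\<close> inside the logarithm; integrating
  the powers of the logarithm yields the factorial.\<close>

lemma coprime_sum_ge:
  assumes "W > 0" "y > 0"
  shows "(real (totient W) / real W) ^ k / fact k * max 0 (ln (y / real W ^ k)) ^ k \<le> coprime_sum W k y"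
  using assms(2)
proof (induction k arbitrary: y)
  case (Suc k)
  define \<theta> where "\<theta> = real (totient W) / real W"
  have \<theta>: "\<theta> \<ge> 0" by (simp add: \<theta>_def)
  \<comment> \<open>The bound for \<open>k\<close> at \<open>y / a\<close> involves
    \<open>ln (y' / a)\<close>, so the kernel is cut off at \<open>y'\<close>; the terms with
    \<open>a\<close> between \<open>y'\<close> and \<open>y\<close> are nonnegative and are
    dropped.\<close>
  define y' where "y' = y / real W ^ k"
  have y': "y' > 0" "y' \<le> y" using assms Suc.prems by (auto simp: y'_def divide_le_eq)
  have "\<theta> ^ Suc k / fact (Suc k) * max 0 (ln (y / real W ^ Suc k)) ^ Suc k =
     \<theta> ^ k / fact k * (\<theta> * max 0 (ln (y' / real W)) ^ Suc k / real (Suc k))"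
    by (simp add: y'_def mult_ac)
  also have "\<dots> \<le> \<theta> ^ k / fact k * (\<Sum>a\<in>coprimes_upto W y'. log_kernel k y' (real a))"
    using sum_log_kernel_coprimes_ge[OF assms(1) y'(1), of k] \<theta> unfolding \<theta>_def
    by (intro mult_left_mono) auto
  also have "\<dots> = (\<Sum>a\<in>coprimes_upto W y'. \<theta> ^ k / fact k * log_kernel k y' (real a))"
    by (rule sum_distrib_left)
  also have "\<dots> \<le> (\<Sum>a\<in>coprimes_upto W y'. coprime_sum W k (y / real a) / real a)"
  proof (rule sum_mono)
    fix a assume "a \<in> coprimes_upto W y'"
    hence a: "a > 0" "real a \<le> y'" by (auto simp: coprimes_upto_def)
    have "ln (y' / real a) \<ge> 0" using a by simp
    hence "\<theta> ^ k / fact k * log_kernel k y' (real a) = 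
       (\<theta> ^ k / fact k * max 0 (ln (y / real a / real W ^ k)) ^ k) / real a"
      using a by (simp add: log_kernel_def y'_def field_simps)
    also have "\<dots> \<le> coprime_sum W k (y / real a) / real a"
      unfolding \<theta>_def by (intro divide_right_mono Suc.IH) (use a Suc.prems in auto)
    finally show "\<theta> ^ k / fact k * log_kernel k y' (real a) \<le> coprime_sum W k (y / real a) / real a" .
  qed
  also have "\<dots> \<le> (\<Sum>a\<in>coprimes_upto W y. coprime_sum W k (y / real a) / real a)"
    by (rule sum_mono2[OF finite_coprimes_upto]) (use y' coprime_sum_nonneg in \<open>auto simp: coprimes_upto_def\<close>)
  finally show ?case by (simp add: \<theta>_def)
qed simp

section \<open>Triples of integers coprime to \<open>W\<close> and the loss from non-squarefree
  products\<close>

definition triples :: "nat \<Rightarrow> real \<Rightarrow> (nat \<times> nat \<times> nat) set" where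
  "triples W y = {(a, b, c). 0 < a \<and> 0 < b \<and> 0 < c \<and> coprime a W \<and> coprime b W \<and> coprime c W \<and>
     real (a * b * c) \<le> y}"

definition triple_prod :: "nat \<times> nat \<times> nat \<Rightarrow> nat" where
  "triple_prod = (\<lambda>(a, b, c). a * b * c)"

lemma triples_eq_Sigma:
  "triples W y = Sigma (coprimes_upto W y) (\<lambda>a. Sigma (coprimes_upto W (y / real a)) (\<lambda>b. coprimes_upto W (y / real a / real b)))"
proof -
  have "real (a * b * c) \<le> y \<longleftrightarrow> real a \<le> y \<and> real b \<le> y / real a \<and> real c \<le> y / real a / real b"
    if "0 < a" "0 < b" "0 < c" for a b c :: nat
  proof -
    have "real c \<le> y / real a / real b \<longleftrightarrow> real (a * b * c) \<le> y" using that by (simp add: field_simps)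
    moreover have "real b \<le> y / real a \<longleftrightarrow> real (a * b) \<le> y" using that by (simp add: field_simps)
    moreover have "a \<le> a * b" "a * b \<le> a * b * c" using that by auto
    hence "real a \<le> real (a * b)" "real (a * b) \<le> real (a * b * c)" by (simp_all only: of_nat_le_iff)
    ultimately show ?thesis by linarith
  qed
  thus ?thesis unfolding triples_def coprimes_upto_def by auto
qed

lemma finite_triples [simp]: "finite (triples W y)"
  unfolding triples_eq_Sigma by (intro finite_SigmaI) auto

lemma sum_triples: "(\<Sum>t\<in>triples W y. 1 / real (triple_prod t)) = coprime_sum W 3 y"
proof -
  have "coprime_sum W 3 y = (\<Sum>a\<in>coprimes_upto W y. \<Sum>b\<in>coprimes_upto W (y / real a). 
      \<Sum>c\<in>coprimes_upto W (y / real a / real b). 1 / real (triple_prod (a, b, c)))"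
    by (simp add: numeral_3_eq_3 sum_divide_distrib triple_prod_def mult_ac)
  also have "\<dots> = (\<Sum>t\<in>triples W y. 1 / real (triple_prod t))"
    unfolding triples_eq_Sigma by (subst sum.Sigma, simp, simp)+ (simp add: split_def)
  finally show ?thesis ..
qed

text \<open>Either \<open>p\<close> divides two of the entries, or two entries are prime to
  \<open>p\<close> and the third absorbs the whole square.\<close>

lemma prime_square_dvd_triple:
  fixes p a b c :: nat
  assumes p: "prime p" and dvd: "p ^ 2 dvd a * b * c"
  shows "\<exists>(i, j, k) \<in> {(2, 0, 0), (0, 2, 0), (0, 0, 2), (1, 1, 0), (1, 0, 1), (0, 1, 1)}.
    p ^ i dvd a \<and> p ^ j dvd b \<and> p ^ k dvd c"
proof -
  have cop: "coprime (p ^ 2) x" if "\<not> p dvd x" for x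
    using prime_imp_coprime[OF p that] by simp
  consider "p dvd a \<and> p dvd b" | "p dvd a \<and> p dvd c" | "p dvd b \<and> p dvd c" 
    | "\<not> p dvd b \<and> \<not> p dvd c" | "\<not> p dvd a \<and> \<not> p dvd c" | "\<not> p dvd a \<and> \<not> p dvd b" by blast
  thus ?thesis
  proof cases
    case 4
    hence "p ^ 2 dvd a" using dvd cop coprime_dvd_mult_left_iff by (metis mult.assoc coprime_mult_right_iff)
    thus ?thesis by simp
  next
    case 5
    hence "p ^ 2 dvd b" using dvd cop coprime_dvd_mult_left_iff coprime_dvd_mult_right_iff by metis
    thus ?thesis by simp
  next
    case 6
    hence "p ^ 2 dvd c" using dvd cop coprime_dvd_mult_right_iff coprime_mult_right_iff by metis
    thus ?thesis by simp
  qed simp_all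
qed

text \<open>Dividing out the prescribed powers of \<open>p\<close> leads back into
  \<open>triples W y\<close>, and since the exponents add up to 2 each reciprocal gains the factor
  \<open>1 / p^2\<close>.\<close>

lemma sum_triples_dvd_le:
  fixes p i j k :: nat
  assumes p: "prime p" and ijk: "i + j + k = 2"
  shows "(\<Sum>t\<in>{(a, b, c). (a, b, c) \<in> triples W y \<and> p ^ i dvd a \<and> p ^ j dvd b \<and> p ^ k dvd c}. 1 / real (triple_prod t))
    \<le> coprime_sum W 3 y / real p ^ 2"
proof -
  have p0: "p > 0" using p prime_gt_0_nat by blast
  define \<phi> where "\<phi> = (\<lambda>(a, b, c). (p ^ i * a, p ^ j * b, p ^ k * c))"
  have inj: "inj_on \<phi> (triples W y)" using p0 by (auto simp: inj_on_def \<phi>_def)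
  have "{(a, b, c). (a, b, c) \<in> triples W y \<and> p ^ i dvd a \<and> p ^ j dvd b \<and> p ^ k dvd c} \<subseteq> \<phi> ` triples W y"
  proof clarify
    fix a b c assume t: "(a, b, c) \<in> triples W y" and dvd: "p ^ i dvd a" "p ^ j dvd b" "p ^ k dvd c"
    obtain a' b' c' where eq: "a = p ^ i * a'" "b = p ^ j * b'" "c = p ^ k * c'"
      using dvd by (meson dvdE)
    have "a' * b' * c' dvd a * b * c" unfolding eq by (intro mult_dvd_mono) auto
    moreover have "a * b * c > 0" using t by (simp add: triples_def)
    ultimately have "a' * b' * c' \<le> a * b * c" by (rule dvd_imp_le)
    hence "real (a' * b' * c') \<le> real (a * b * c)" by (simp only: of_nat_le_iff)
    moreover have "real (a * b * c) \<le> y" using t by (simp add: triples_def)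
    ultimately have "real (a' * b' * c') \<le> y" by linarith
    moreover have "0 < a'" "0 < b'" "0 < c'" using t eq by (auto simp: triples_def intro: Nat.gr0I)
    moreover have "coprime a' W" "coprime b' W" "coprime c' W"
      using t eq by (auto simp: triples_def)
    ultimately have "(a', b', c') \<in> triples W y" unfolding triples_def by blast
    moreover have "(a, b, c) = \<phi> (a', b', c')" by (simp add: \<phi>_def eq)
    ultimately show "(a, b, c) \<in> \<phi> ` triples W y" by blast
  qed
  hence "(\<Sum>t\<in>{(a, b, c). (a, b, c) \<in> triples W y \<and> p ^ i dvd a \<and> p ^ j dvd b \<and> p ^ k dvd c}. 1 / real (triple_prod t))
     \<le> (\<Sum>t\<in>\<phi> ` triples W y. 1 / real (triple_prod t))"
    by (intro sum_mono2) auto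
  also have "\<dots> = (\<Sum>t\<in>triples W y. 1 / real (triple_prod (\<phi> t)))"
    by (simp add: sum.reindex[OF inj])
  also have "\<dots> = (\<Sum>t\<in>triples W y. 1 / real (triple_prod t) / real p ^ 2)"
  proof (rule sum.cong)
    fix t :: "nat \<times> nat \<times> nat"
    obtain a b c where t: "t = (a, b, c)" by (cases t)
    have "triple_prod (\<phi> t) = p ^ (i + j + k) * triple_prod t"
      by (simp add: t triple_prod_def \<phi>_def power_add mult_ac)
    thus "1 / real (triple_prod (\<phi> t)) = 1 / real (triple_prod t) / real p ^ 2"
      by (simp add: ijk)
  qed simp
  also have "\<dots> = coprime_sum W 3 y / real p ^ 2"
    by (simp only: sum_divide_distrib[symmetric] sum_triples)
  finally show ?thesis .
qed

text \<open>Each \<open>1 / n^2\<close> is at most \<open>1 / (n - 1) - 1 / n\<close>, and these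
  differences telescope.\<close>

lemma sum_inverse_squares_le:
  assumes "w > 0"
  shows "(\<Sum>n\<in>{w<..w + m}. 1 / real n ^ 2) \<le> 1 / real w - 1 / real (w + m)"
proof (induction m)
  case (Suc m)
  have "{w<..w + Suc m} = insert (w + Suc m) {w<..w + m}" by auto
  hence "(\<Sum>n\<in>{w<..w + Suc m}. 1 / real n ^ 2) = 1 / real (w + Suc m) ^ 2 + (\<Sum>n\<in>{w<..w + m}. 1 / real n ^ 2)"
    by simp
  moreover have "1 / (x + 1) ^ 2 \<le> 1 / x - 1 / (x + 1)" if "x > 0" for x :: real
  proof -
    have "1 / (x + 1) ^ 2 \<le> 1 / (x * (x + 1))"
      using that by (intro divide_left_mono) (auto simp: power2_eq_square)
    also have "\<dots> = 1 / x - 1 / (x + 1)" using that by (simp add: field_simps)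
    finally show ?thesis .
  qed
  from this[of "real (w + m)"]
  have "1 / real (w + Suc m) ^ 2 \<le> 1 / real (w + m) - 1 / real (w + Suc m)"
    using assms by (simp add: add_ac)
  ultimately show ?case using Suc by simp
qed simp

text \<open>A prime whose square divides the product is prime to \<open>W\<close>, hence exceeds
  \<open>w\<close>. A union bound over these primes and the 6 ways of distributing the square costs
  \<open>1 / p^2\<close> each, and the sum of \<open>1 / p^2\<close> over \<open>p > w\<close> is at
  most \<open>1 / w\<close>.\<close>

lemma sum_nonsquarefree_triples_le:
  assumes w: "w > 0" and W: "\<And>p. prime p \<Longrightarrow> p \<le> w \<Longrightarrow> p dvd W"
  shows "(\<Sum>t\<in>{t \<in> triples W y. \<not> squarefree (triple_prod t)}. 1 / real (triple_prod t))
    \<le> 6 / real w * coprime_sum W 3 y"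
proof -
  define PP where "PP = {p. prime p \<and> w < p \<and> real p \<le> y}"
  define X :: "(nat \<times> nat \<times> nat) set" where "X = {(2, 0, 0), (0, 2, 0), (0, 0, 2), (1, 1, 0), (1, 0, 1), (0, 1, 1)}"
  define E where "E = (\<lambda>p (i, j, k). {(a, b, c). (a, b, c) \<in> triples W y \<and> p ^ i dvd a \<and> p ^ j dvd b \<and> p ^ k dvd c})"
  let ?f = "\<lambda>t. 1 / real (triple_prod t)"
  have fPP: "finite PP"
    by (rule finite_subset[of _ "{..nat \<lfloor>y\<rfloor>}"]) (auto simp: PP_def le_nat_floor)
  have fX: "finite X" by (simp add: X_def)
  have "(\<Sum>t\<in>{t \<in> triples W y. \<not> squarefree (triple_prod t)}. ?f t) \<le> 
    (\<Sum>t\<in>triples W y. \<Sum>p\<in>PP. \<Sum>e\<in>X. if t \<in> E p e then ?f t else 0)"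
    unfolding sum.inter_filter[OF finite_triples]
  proof (rule sum_mono)
    fix t assume t: "t \<in> triples W y"
    have nn: "0 \<le> (\<Sum>e\<in>X. if t \<in> E p e then ?f t else 0)" for p by (intro sum_nonneg) auto
    show "(if \<not> squarefree (triple_prod t) then ?f t else 0) \<le> (\<Sum>p\<in>PP. \<Sum>e\<in>X. if t \<in> E p e then ?f t else 0)"
    proof (cases "squarefree (triple_prod t)")
      case True
      thus ?thesis using nn by (auto intro: sum_nonneg)
    next
      case False
      obtain a b c where tt: "t = (a, b, c)" by (cases t)
      have pos: "triple_prod t > 0" and le: "real (triple_prod t) \<le> y" and cop: "coprime (triple_prod t) W"
        using t by (auto simp: tt triples_def triple_prod_def)
      obtain p where p: "prime p" "p ^ 2 dvd triple_prod t"
        using False pos squarefree_factorial_semiring[of "triple_prod t"] by blast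
      have "p dvd triple_prod t" using p(2) dvd_mult_left by (auto simp: power2_eq_square)
      hence "\<not> p dvd W" using cop p(1) by (meson coprime_common_divisor not_prime_unit)
      hence "w < p" using W p(1) by (meson not_le)
      moreover have "p \<le> triple_prod t" using \<open>p dvd triple_prod t\<close> pos by (rule dvd_imp_le)
      hence "real p \<le> y" using le by linarith
      ultimately have pPP: "p \<in> PP" using p(1) by (simp add: PP_def)
      have "p ^ 2 dvd a * b * c" using p(2) by (simp add: tt triple_prod_def)
      from prime_square_dvd_triple[OF p(1) this] obtain e where 
        e: "e \<in> X" "case e of (i, j, k) \<Rightarrow> p ^ i dvd a \<and> p ^ j dvd b \<and> p ^ k dvd c"
        unfolding X_def by (rule bexE)
      hence "t \<in> E p e" using t by (auto simp: E_def tt)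
      hence "?f t = (if t \<in> E p e then ?f t else 0)" by simp
      also have "\<dots> \<le> (\<Sum>e\<in>X. if t \<in> E p e then ?f t else 0)"
        by (rule member_le_sum[OF e(1)]) (use fX in auto)
      also have "\<dots> \<le> (\<Sum>p\<in>PP. \<Sum>e\<in>X. if t \<in> E p e then ?f t else 0)"
        by (rule member_le_sum[OF pPP]) (use nn fPP in auto)
      finally show ?thesis using False by simp
    qed
  qed
  also have "\<dots> = (\<Sum>p\<in>PP. \<Sum>t\<in>triples W y. \<Sum>e\<in>X. if t \<in> E p e then ?f t else 0)"
    by (rule sum.swap)
  also have "\<dots> = (\<Sum>p\<in>PP. \<Sum>e\<in>X. \<Sum>t\<in>triples W y. if t \<in> E p e then ?f t else 0)"
    by (intro sum.cong refl sum.swap)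
  also have "\<dots> \<le> (\<Sum>p\<in>PP. \<Sum>e\<in>X. coprime_sum W 3 y / real p ^ 2)"
  proof (intro sum_mono)
    fix p e assume p: "p \<in> PP" and e: "e \<in> X"
    obtain i j k where ijk: "e = (i, j, k)" by (cases e)
    have "(\<Sum>t\<in>triples W y. if t \<in> E p e then ?f t else 0) = (\<Sum>t\<in>E p e. ?f t)"
      unfolding sum.inter_filter[OF finite_triples, symmetric]
      by (rule sum.cong) (auto simp: E_def ijk)
    also have "\<dots> \<le> coprime_sum W 3 y / real p ^ 2"
      unfolding E_def ijk prod.case
      by (rule sum_triples_dvd_le) (use p e ijk in \<open>auto simp: PP_def X_def\<close>)
    finally show "(\<Sum>t\<in>triples W y. if t \<in> E p e then ?f t else 0) \<le> coprime_sum W 3 y / real p ^ 2" .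
  qed
  also have "\<dots> = 6 * coprime_sum W 3 y * (\<Sum>p\<in>PP. 1 / real p ^ 2)"
    by (simp add: X_def sum_distrib_left)
  also have "(\<Sum>p\<in>PP. 1 / real p ^ 2) \<le> (\<Sum>n\<in>{w<..w + nat \<lfloor>y\<rfloor>}. 1 / real n ^ 2)"
    by (rule sum_mono2) (auto simp: PP_def intro!: trans_le_add2 le_nat_floor)
  also have "\<dots> \<le> 1 / real w" 
    using sum_inverse_squares_le[OF w, of "nat \<lfloor>y\<rfloor>"] by (smt (verit) divide_nonneg_nonneg of_nat_0_le_iff)
  finally show ?thesis using coprime_sum_nonneg[of W 3 y] by (simp add: mult_left_mono)
qed

lemma prod_prime_factors_squarefree:
  fixes n :: nat
  assumes "squarefree n"
  shows "\<Prod>(prime_factors n) = n"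
proof -
  have "n \<noteq> 0" using assms by (metis not_squarefree_0)
  hence "n = (\<Prod>p\<in>prime_factors n. p ^ multiplicity p n)" by (simp add: prime_factorization_nat)
  also have "\<dots> = (\<Prod>p\<in>prime_factors n. p)"
    using assms squarefree_factorial_semiring'[OF \<open>n \<noteq> 0\<close>] by (intro prod.cong) auto
  finally show ?thesis ..
qed

text \<open>A triple with squarefree product is determined by which of its entries each prime divides.\<close>

lemma card_squarefree_triples_le:
  fixes T :: "nat set"
  assumes T: "finite T"
  shows "card {t \<in> triples W y. squarefree (triple_prod t) \<and> prime_factors (triple_prod t) = T} \<le> 3 ^ card T"
proof -
  define Q where "Q = {t \<in> triples W y. squarefree (triple_prod t) \<and> prime_factors (triple_prod t) = T}"
  \<comment> \<open>The label of a prime in \<open>T\<close> names the entry it divides; the default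
    2 stands for \<open>c\<close>, which is later recovered from the common product
    \<open>\<Prod>T\<close>.\<close>
  define g where "g = (\<lambda>(a, b, c :: nat). \<lambda>p\<in>T. if p dvd a then 0 else if p dvd b then 1 else (2::nat))"
  have prodT: "a * b * c = \<Prod>T" "0 < a" "0 < b" "0 < c"
    and a_eq: "a = \<Prod>{p \<in> T. g (a, b, c) p = 0}" and b_eq: "b = \<Prod>{p \<in> T. g (a, b, c) p = 1}"
    if t: "(a, b, c) \<in> Q" for a b c
  proof -
    have sf: "squarefree (a * b * c)" and pf: "prime_factors (a * b * c) = T"
      and pos: "0 < a" "0 < b" "0 < c"
      using t by (auto simp: Q_def triple_prod_def triples_def)
    show "0 < a" "0 < b" "0 < c" using pos by auto
    show "a * b * c = \<Prod>T" using prod_prime_factors_squarefree[OF sf] pf by simp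
    have sfa: "squarefree a" and sfb: "squarefree b"
      using sf by (meson squarefree_mono dvd_triv_left dvd_triv_right dvd_mult2)+
    have primeT: "p \<in> T \<longleftrightarrow> prime p \<and> p dvd a * b * c" for p
      unfolding pf[symmetric] using pos by (auto simp: prime_factors_dvd)
    have pa: "prime_factors a = {p \<in> T. g (a, b, c) p = 0}"
      using pos by (auto simp: prime_factors_dvd primeT g_def split: if_splits)
    show "a = \<Prod>{p \<in> T. g (a, b, c) p = 0}"
      unfolding pa[symmetric] using prod_prime_factors_squarefree[OF sfa] ..
    have "\<not> (p dvd a \<and> p dvd b)" if "prime p" for p
    proof
      assume "p dvd a \<and> p dvd b"
      hence "p * p dvd a * b * c" by (intro dvd_mult2 mult_dvd_mono) auto
      hence "p dvd 1" using squarefreeD[OF sf, of p] by (simp add: power2_eq_square)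
      thus False using that by simp
    qed
    hence pb: "prime_factors b = {p \<in> T. g (a, b, c) p = 1}"
      using pos by (auto simp: prime_factors_dvd primeT g_def split: if_splits)
    show "b = \<Prod>{p \<in> T. g (a, b, c) p = 1}"
      unfolding pb[symmetric] using prod_prime_factors_squarefree[OF sfb] ..
  qed
  have inj: "inj_on g Q"
  proof (rule inj_onI)
    fix t t' assume t: "t \<in> Q" "t' \<in> Q" "g t = g t'"
    obtain a b c where tt: "t = (a, b, c)" by (cases t)
    obtain a' b' c' where tt': "t' = (a', b', c')" by (cases t')
    have t1: "(a, b, c) \<in> Q" "(a', b', c') \<in> Q" "g (a, b, c) = g (a', b', c')" using t tt tt' by auto
    have a: "a = a'" using a_eq[OF t1(1)] a_eq[OF t1(2)] unfolding t1(3) by (rule trans[OF _ sym])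
    have b: "b = b'" using b_eq[OF t1(1)] b_eq[OF t1(2)] unfolding t1(3) by (rule trans[OF _ sym])
    have "a * b * c = a' * b' * c'" using prodT(1)[OF t1(1)] prodT(1)[OF t1(2)] by (rule trans[OF _ sym])
    hence "c = c'" using a b prodT(2,3)[OF t1(1)] by simp
    thus "t = t'" using a b tt tt' by simp
  qed
  have "g ` Q \<subseteq> T \<rightarrow>\<^sub>E {0, 1, 2}" by (auto simp: g_def split: if_splits)
  hence "card (g ` Q) \<le> card (T \<rightarrow>\<^sub>E {0, 1, 2::nat})" using T by (intro card_mono finite_PiE) auto
  hence "card Q \<le> 3 ^ card T" using T card_image[OF inj] by (simp add: card_funcsetE numeral_3_eq_3)
  thus ?thesis by (simp add: Q_def)
qed

text \<open>The squarefree numbers up to \<open>y\<close> with all prime factors above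
  \<open>w\<close>. Finiteness is demanded because an infinite set has product 1 by
  convention.\<close>

definition rough_sets :: "nat \<Rightarrow> real \<Rightarrow> nat set set" where
  "rough_sets w y = {T. finite T \<and> T \<subseteq> {p. prime p \<and> w < p} \<and> real (\<Prod>T) \<le> y}"

lemma member_dvd_prod: "finite T \<Longrightarrow> p \<in> T \<Longrightarrow> p dvd \<Prod>T" for p :: nat
  using dvd_prodI[of T p "\<lambda>p. p"] by simp

lemma member_le_prod:
  fixes T :: "nat set"
  assumes "finite T" "T \<subseteq> {p. prime p}" "p \<in> T"
  shows "p \<le> \<Prod>T"
proof (rule dvd_imp_le)
  show "p dvd \<Prod>T" using assms by (simp add: member_dvd_prod)
  show "0 < \<Prod>T" using assms prime_gt_0_nat by (intro prod_pos) auto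
qed

lemma finite_rough_sets [simp]: "finite (rough_sets w y)"
proof (rule finite_subset[of _ "Pow {..nat \<lfloor>y\<rfloor>}"])
  show "rough_sets w y \<subseteq> Pow {..nat \<lfloor>y\<rfloor>}"
  proof (intro subsetI PowI)
    fix T p assume "T \<in> rough_sets w y" "p \<in> T"
    hence "p \<le> \<Prod>T" "real (\<Prod>T) \<le> y" by (auto simp: rough_sets_def intro!: member_le_prod)
    hence "real p \<le> y" by (meson of_nat_le_iff order_trans)
    thus "p \<in> {..nat \<lfloor>y\<rfloor>}" by (simp add: le_nat_floor)
  qed
qed simp

text \<open>The triples with squarefree product keep at least the fraction \<open>1 - 6 / w\<close>
  of the sum. Grouped by the set \<open>T\<close> of primes dividing the product, at most
  \<open>3 ^ card T\<close> of them share one \<open>T\<close>.\<close>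

lemma sum_rough_sets_ge:
  assumes w: "w > 0" and W: "\<And>p. prime p \<Longrightarrow> p \<le> w \<Longrightarrow> p dvd W"
  shows "(1 - 6 / real w) * coprime_sum W 3 y \<le> (\<Sum>T\<in>rough_sets w y. 3 ^ card T / real (\<Prod>T))"
proof -
  let ?f = "\<lambda>t. 1 / real (triple_prod t)"
  let ?Q = "{t \<in> triples W y. squarefree (triple_prod t)}"
  have "coprime_sum W 3 y = (\<Sum>t\<in>?Q. ?f t) + (\<Sum>t\<in>{t \<in> triples W y. \<not> squarefree (triple_prod t)}. ?f t)"
    unfolding sum_triples[symmetric]
    by (subst sum.union_disjoint[symmetric]) (auto intro!: sum.cong)
  with sum_nonsquarefree_triples_le[OF w W, of y]
  have "(1 - 6 / real w) * coprime_sum W 3 y \<le> (\<Sum>t\<in>?Q. ?f t)"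
    by (simp add: algebra_simps)
  also have "\<dots> = (\<Sum>T\<in>rough_sets w y. \<Sum>t\<in>{t. t \<in> ?Q \<and> prime_factors (triple_prod t) = T}. ?f t)"
  proof (rule sum.group[symmetric])
    show "(\<lambda>t. prime_factors (triple_prod t)) ` ?Q \<subseteq> rough_sets w y"
    proof clarify
      fix a b c assume t: "(a, b, c) \<in> triples W y" "squarefree (triple_prod (a, b, c))"
      have cop: "coprime (triple_prod (a, b, c)) W" and le: "real (triple_prod (a, b, c)) \<le> y"
        using t by (auto simp: triples_def triple_prod_def)
      have "w < p" if "p \<in> prime_factors (triple_prod (a, b, c))" for p
      proof (rule ccontr)
        have p: "prime p" "p dvd triple_prod (a, b, c)"
          using that in_prime_factors_imp_prime in_prime_factors_imp_dvd by blast+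
        assume "\<not> w < p"
        hence "p dvd W" using W p by simp
        hence "is_unit p" using cop p(2) coprime_common_divisor by blast
        thus False using p(1) by simp
      qed
      hence "prime_factors (triple_prod (a, b, c)) \<subseteq> {p. prime p \<and> w < p}"
        using in_prime_factors_imp_prime by blast
      thus "prime_factors (triple_prod (a, b, c)) \<in> rough_sets w y"
        using le prod_prime_factors_squarefree[OF t(2)] by (simp add: rough_sets_def del: of_nat_prod)
    qed
  qed auto
  also have "\<dots> \<le> (\<Sum>T\<in>rough_sets w y. 3 ^ card T / real (\<Prod>T))"
  proof (rule sum_mono)
    fix T assume T: "T \<in> rough_sets w y"
    let ?F = "{t. t \<in> ?Q \<and> prime_factors (triple_prod t) = T}"
    have "?F = {t \<in> triples W y. squarefree (triple_prod t) \<and> prime_factors (triple_prod t) = T}" by auto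
    hence "card ?F \<le> 3 ^ card T" using T card_squarefree_triples_le[of T W y] by (simp add: rough_sets_def)
    hence "real (card ?F) \<le> real (3 ^ card T)" by (simp only: of_nat_le_iff)
    hence c: "real (card ?F) \<le> 3 ^ card T" by simp
    have "(\<Sum>t\<in>?F. ?f t) = (\<Sum>t\<in>?F. 1 / real (\<Prod>T))"
      by (rule sum.cong) (auto simp: prod_prime_factors_squarefree simp del: of_nat_prod)
    also have "\<dots> = real (card ?F) / real (\<Prod>T)" by simp
    also have "\<dots> \<le> 3 ^ card T / real (\<Prod>T)" by (intro divide_right_mono c of_nat_0_le_iff)
    finally show "(\<Sum>t\<in>?F. ?f t) \<le> 3 ^ card T / real (\<Prod>T)" .
  qed
  finally show ?thesis .
qed

text \<open>Any set of primes up to \<open>w\<close> may be joined to a rough set whose product is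
  at most \<open>z\<close> divided by \<open>\<Prod>P\<close>, and the union stays in the support.
  The first part sums to the Euler product because
  \<open>1 + rho p / (1 - rho p) = 1 / (1 - rho p)\<close>. In the second, \<open>w \<ge> 4\<close>
  forces \<open>rho p = 3 / p\<close>, which is at most \<open>rho p / (1 - rho p)\<close>.\<close>

lemma sieve_sum_ge_rough:
  assumes w: "w \<ge> 4"
  defines "P \<equiv> {p. prime p \<and> p \<le> w}"
  shows "(\<Prod>p\<in>P. 1 / (1 - rho p)) * (\<Sum>T\<in>rough_sets w (z / real (\<Prod>P)). 3 ^ card T / real (\<Prod>T)) \<le> sieve_sum z"
proof -
  let ?g = "\<lambda>p. rho p / (1 - rho p)"
  let ?V = "rough_sets w (z / real (\<Prod>P))"
  have finP: "finite P" by (simp add: P_def)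
  have Ppos: "\<Prod>P > 0" using prime_gt_0_nat by (intro prod_pos) (auto simp: P_def)
  have g0: "?g p \<ge> 0" if "prime p" for p using rho_pos[OF that] rho_le[OF that] by simp
  have disj: "T1 \<inter> T2 = {}" "finite T1" "finite T2" if "T1 \<in> Pow P" "T2 \<in> ?V" for T1 T2
  proof -
    have "T1 \<subseteq> {p. p \<le> w}" "T2 \<subseteq> {p. w < p}" using that by (auto simp: P_def rough_sets_def)
    thus "T1 \<inter> T2 = {}" by fastforce
    show "finite T1" using that finite_subset[OF _ finP] by blast
    show "finite T2" using that by (simp add: rough_sets_def)
  qed
  have inj: "inj_on (\<lambda>t. fst t \<union> snd t) (Pow P \<times> ?V)"
  proof (rule inj_onI)
    fix t t' assume t: "t \<in> Pow P \<times> ?V" "t' \<in> Pow P \<times> ?V" "fst t \<union> snd t = fst t' \<union> snd t'"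
    have "fst s = (fst s \<union> snd s) \<inter> {p. p \<le> w} \<and> snd s = (fst s \<union> snd s) - {p. p \<le> w}"
      if "s \<in> Pow P \<times> ?V" for s
    proof -
      have "fst s \<subseteq> {p. p \<le> w}" "snd s \<subseteq> {p. w < p}" using that by (auto simp: P_def rough_sets_def)
      thus ?thesis by fastforce
    qed
    from this[OF t(1)] this[OF t(2)] show "t = t'" unfolding t(3) by (simp add: prod_eq_iff)
  qed
  have "(\<Prod>p\<in>P. 1 / (1 - rho p)) = (\<Prod>p\<in>P. ?g p + 1)"
  proof (rule prod.cong)
    fix p assume "p \<in> P"
    hence "rho p < 1" using rho_le[of p] by (simp add: P_def)
    thus "1 / (1 - rho p) = ?g p + 1" by (simp add: field_simps)
  qed simp
  also have "\<dots> = (\<Sum>T1\<in>Pow P. prod ?g T1)"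
    by (subst prod_add[OF finP]) simp
  finally have "(\<Prod>p\<in>P. 1 / (1 - rho p)) * (\<Sum>T\<in>?V. 3 ^ card T / real (\<Prod>T)) =
      (\<Sum>T1\<in>Pow P. \<Sum>T2\<in>?V. prod ?g T1 * (3 ^ card T2 / real (\<Prod>T2)))"
    by (simp add: sum_product)
  also have "\<dots> \<le> (\<Sum>T1\<in>Pow P. \<Sum>T2\<in>?V. prod ?g (T1 \<union> T2))"
  proof (intro sum_mono)
    fix T1 T2 assume T: "T1 \<in> Pow P" "T2 \<in> ?V"
    have "(3 ^ card T2 / real (\<Prod>T2)) = (\<Prod>p\<in>T2. 3 / real p)" by (simp add: prod_dividef)
    also have "\<dots> \<le> prod ?g T2"
    proof (rule prod_mono)
      fix p assume "p \<in> T2"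
      hence "prime p" "p > 4" using T w by (auto simp: rough_sets_def)
      hence "rho p = 3 / real p" by (simp add: rho_def om_def)
      moreover have "rho p \<le> ?g p" using rho_pos[OF \<open>prime p\<close>] rho_le[OF \<open>prime p\<close>]
        by (simp add: field_simps)
      ultimately show "0 \<le> 3 / real p \<and> 3 / real p \<le> ?g p" by simp
    qed
    finally have "prod ?g T1 * (3 ^ card T2 / real (\<Prod>T2)) \<le> prod ?g T1 * prod ?g T2"
      by (rule mult_left_mono) (use T g0 in \<open>auto intro!: prod_nonneg simp: P_def\<close>)
    also have "\<dots> = prod ?g (T1 \<union> T2)"
      using disj[OF T] by (simp add: prod.union_disjoint)
    finally show "prod ?g T1 * (3 ^ card T2 / real (\<Prod>T2)) \<le> prod ?g (T1 \<union> T2)" .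
  qed
  also have "\<dots> = (\<Sum>(T1, T2)\<in>Pow P \<times> ?V. prod ?g (T1 \<union> T2))"
    by (rule sum.cartesian_product)
  also have "\<dots> = (\<Sum>t\<in>Pow P \<times> ?V. prod ?g (fst t \<union> snd t))" by (simp add: split_def)
  also have "\<dots> = (\<Sum>T\<in>(\<lambda>t. fst t \<union> snd t) ` (Pow P \<times> ?V). prod ?g T)"
    by (simp only: sum.reindex[OF inj] o_def)
  also have "\<dots> \<le> sieve_sum z"
    unfolding sieve_sum_def
  proof (rule sum_mono2[OF finite_sieve_support])
    show "(\<lambda>t. fst t \<union> snd t) ` (Pow P \<times> ?V) \<subseteq> sieve_support z"
    proof (rule image_subsetI)
      fix t assume "t \<in> Pow P \<times> ?V"
      then obtain T1 T2 where t: "t = (T1, T2)" and T: "T1 \<subseteq> P" "T2 \<in> ?V"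
        by (cases t) auto
      let ?T = "T1 \<union> T2"
      have d: "T1 \<inter> T2 = {}" "finite T1" "finite T2" using disj[of T1 T2] T by blast+
      have primes: "?T \<subseteq> {p. prime p}" using T by (auto simp: P_def rough_sets_def)
      have "\<Prod>P = \<Prod>T1 * \<Prod>(P - T1)" using prod.subset_diff[OF T(1) finP, of "\<lambda>p. p"] by (simp add: mult.commute)
      hence "\<Prod>T1 \<le> \<Prod>P" using Ppos by (intro dvd_imp_le) auto
      hence "real (\<Prod>T1) * real (\<Prod>T2) \<le> real (\<Prod>P) * (z / real (\<Prod>P))"
        using T by (intro mult_mono) (simp_all only: of_nat_le_iff rough_sets_def mem_Collect_eq of_nat_0_le_iff)
      moreover have "\<Prod>?T = \<Prod>T1 * \<Prod>T2" using d by (simp add: prod.union_disjoint)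
      ultimately have le: "real (\<Prod>?T) \<le> z" using Ppos by (simp del: of_nat_prod)
      moreover have "real p \<le> z" if "p \<in> ?T" for p
      proof -
        have "p \<le> \<Prod>?T" by (rule member_le_prod[OF _ primes that]) (use d in auto)
        hence "real p \<le> real (\<Prod>?T)" by (simp only: of_nat_le_iff)
        thus ?thesis using le by linarith
      qed
      ultimately show "fst t \<union> snd t \<in> sieve_support z"
        using primes unfolding t sieve_support_def by auto
    qed
    show "0 \<le> prod ?g T" if "T \<in> sieve_support z - (\<lambda>t. fst t \<union> snd t) ` (Pow P \<times> ?V)" for T
      using that g0 by (intro prod_nonneg) (auto simp: sieve_support_def)
  qed
  finally show ?thesis .
qed

text \<open>The cube of \<open>totient W / W\<close>, a product of \<open>1 - 1 / p\<close>, merges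
  into the Euler product, and the 6 is \<open>fact 3\<close>. Of the four factors
  \<open>\<Prod>P\<close> in the logarithm, one makes room for the small primes and three come from
  \<open>coprime_sum_ge\<close>. The hypothesis \<open>w \<ge> 6\<close> keeps
  \<open>1 - 6 / w\<close> nonnegative.\<close>

theorem sieve_sum_ge:
  fixes w :: nat and z :: real
  assumes w: "w \<ge> 6" and z: "z > 0"
  defines "P \<equiv> {p. prime p \<and> p \<le> w}"
  shows "(1 - 6 / real w) * (\<Prod>p\<in>P. (1 - 1 / real p) ^ 3 / (1 - rho p)) / 6 *
     max 0 (ln (z / real (\<Prod>P) ^ 4)) ^ 3 \<le> sieve_sum z"
proof -
  let ?W = "\<Prod>P"
  have finP: "finite P" by (simp add: P_def)
  have Wpos: "?W > 0" using prime_gt_0_nat by (intro prod_pos) (auto simp: P_def)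
  have "prime_factors ?W = P"
  proof
    show "prime_factors ?W \<subseteq> P"
      using Wpos finP by (auto simp: prime_factors_dvd prime_dvd_prod_iff P_def dest: primes_dvd_imp_eq)
    show "P \<subseteq> prime_factors ?W"
      using Wpos finP by (auto simp: prime_factors_dvd P_def intro!: member_dvd_prod)
  qed
  hence tot: "real (totient ?W) / real ?W = (\<Prod>p\<in>P. 1 - 1 / real p)"
    using Wpos by (simp add: totient_formula2 del: of_nat_prod)
  have C: "(\<Prod>p\<in>P. 1 / (1 - rho p)) \<ge> 0"
  proof (rule prod_nonneg)
    show "0 \<le> 1 / (1 - rho p)" if "p \<in> P" for p using that rho_le[of p] by (simp add: P_def)
  qed
  have e1: "(\<Prod>p\<in>P. (1 - 1 / real p) ^ 3 / (1 - rho p)) = 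
      (\<Prod>p\<in>P. 1 / (1 - rho p)) * (real (totient ?W) / real ?W) ^ 3"
    unfolding tot by (simp add: prod_dividef prod_power_distrib)
  have e2: "z / real ?W ^ 4 = z / real ?W / real ?W ^ 3" by (simp add: eval_nat_numeral del: of_nat_prod)
  have e3: "fact 3 = (6 :: real)" by (simp add: fact_numeral)
  have "(1 - 6 / real w) * (\<Prod>p\<in>P. (1 - 1 / real p) ^ 3 / (1 - rho p)) / 6 *
     max 0 (ln (z / real ?W ^ 4)) ^ 3 = (\<Prod>p\<in>P. 1 / (1 - rho p)) * ((1 - 6 / real w) * 
       ((real (totient ?W) / real ?W) ^ 3 / fact 3 * max 0 (ln (z / real ?W / real ?W ^ 3)) ^ 3))"
    unfolding e1 e2 e3 by (simp only: times_divide_eq_left times_divide_eq_right mult_ac)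
  also have "\<dots> \<le> (\<Prod>p\<in>P. 1 / (1 - rho p)) * ((1 - 6 / real w) * coprime_sum ?W 3 (z / real ?W))"
    using w z Wpos by (intro mult_left_mono C coprime_sum_ge) (auto simp del: of_nat_prod)
  also have "\<dots> \<le> (\<Prod>p\<in>P. 1 / (1 - rho p)) * (\<Sum>T\<in>rough_sets w (z / real ?W). 3 ^ card T / real (\<Prod>T))"
    using w finP by (intro mult_left_mono C sum_rough_sets_ge) (auto simp: P_def intro!: member_dvd_prod)
  also have "\<dots> \<le> sieve_sum z" unfolding P_def by (rule sieve_sum_ge_rough) (use w in auto)
  finally show ?thesis .
qed

section \<open>The singular series\<close>

definition singular_factor :: "nat \<Rightarrow> real" where
  "singular_factor n = (if prime n \<and> n \<ge> 5 then (1 - 3 / real n) * inverse ((1 - 1 / real n) ^ 3) else 1)"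

lemma singular_factor_pos: "singular_factor n > 0"
  by (auto simp: singular_factor_def intro!: mult_pos_pos)

text \<open>With \<open>u = 1 / n\<close> the terms of order \<open>u\<close> cancel, leaving a
  numerator of size at most \<open>3 * u ^ 2\<close>; since \<open>u \<le> 1 / 5\<close>, the
  denominator is at least \<open>(4 / 5) ^ 3 > 1 / 2\<close>.\<close>

lemma singular_factor_dist: "\<bar>singular_factor n - 1\<bar> \<le> 6 * inverse (real n ^ 2)"
proof (cases "prime n \<and> n \<ge> 5")
  case True
  define u where "u = 1 / real n"
  have u: "0 < u" "u \<le> 1 / 5" using True by (auto simp: u_def field_simps)
  have "(4 / 5) ^ 3 \<le> (1 - u) ^ 3" using u by (intro power_mono) auto
  hence d: "1 / 2 \<le> (1 - u) ^ 3" by (simp add: power3_eq_cube)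
  have "singular_factor n - 1 = (1 - 3 * u) / (1 - u) ^ 3 - 1"
    using True by (simp add: singular_factor_def u_def field_simps)
  also have "\<dots> = - (3 * u ^ 2 - u ^ 3) / (1 - u) ^ 3"
    using u by (simp add: field_simps) (simp add: power2_eq_square power3_eq_cube algebra_simps)
  finally have eq: "singular_factor n - 1 = - (3 * u ^ 2 - u ^ 3) / (1 - u) ^ 3" .
  have pos: "(1 - u) ^ 3 > 0" using d by linarith
  have "\<bar>singular_factor n - 1\<bar> = \<bar>3 * u ^ 2 - u ^ 3\<bar> / (1 - u) ^ 3"
    by (simp only: eq abs_divide abs_minus_cancel abs_of_pos[OF pos])
  also have "u ^ 3 \<le> u ^ 2" using u by (simp add: power3_eq_cube power2_eq_square)
  hence "\<bar>3 * u ^ 2 - u ^ 3\<bar> \<le> 3 * u ^ 2"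
    using zero_le_power[of u 3] u by (intro abs_leI) linarith+
  hence "\<bar>3 * u ^ 2 - u ^ 3\<bar> / (1 - u) ^ 3 \<le> 3 * u ^ 2 / (1 / 2)"
    using d by (intro frac_le) auto
  finally show ?thesis by (simp add: u_def field_simps)
next
  case False
  thus ?thesis by (auto simp: singular_factor_def)
qed

lemma convergent_prod_singular_factor: "convergent_prod singular_factor"
proof (intro abs_convergent_prod_imp_convergent_prod summable_imp_abs_convergent_prod)
  have "summable (\<lambda>n. 6 * inverse (real n ^ 2))"
    by (intro summable_mult inverse_power_summable) simp
  thus "summable (\<lambda>n. norm (singular_factor n - 1))"
    by (rule summable_comparison_test'[of _ 0]) (use singular_factor_dist in simp)
qed

lemma singular_series_A_eq: "singular_series_A = 9 * prodinf singular_factor"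
  unfolding singular_series_A_def singular_factor_def by simp

text \<open>As a limit of positive partial products the value is nonnegative, and a convergent
  infinite product without zero factors is nonzero.\<close>

lemma singular_series_A_pos: "singular_series_A > 0"
proof -
  have lim: "(\<lambda>n. \<Prod>i\<le>n. singular_factor i) \<longlonglongrightarrow> prodinf singular_factor"
    by (rule convergent_prod_LIMSEQ[OF convergent_prod_singular_factor])
  have "prodinf singular_factor \<ge> 0"
    by (rule LIMSEQ_le_const[OF lim]) (auto intro!: prod_nonneg less_imp_le[OF singular_factor_pos])
  moreover have "prodinf singular_factor \<noteq> 0"
    using prodinf_nonzero[OF convergent_prod_singular_factor] singular_factor_pos by (metis less_irrefl)
  ultimately show ?thesis by (simp add: singular_series_A_eq)
qed

text \<open>For \<open>p \<ge> 5\<close> the local factor is the reciprocal of the singular factor.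
  The primes 2 and 3 give \<open>1 / 4\<close> and \<open>4 / 9\<close>, whose product
  \<open>1 / 9\<close> accounts for the 9 in the singular series.\<close>

lemma prod_density_eq:
  assumes "w \<ge> 3"
  shows "(\<Prod>p\<in>{p. prime p \<and> p \<le> w}. (1 - 1 / real p) ^ 3 / (1 - rho p)) = 1 / (9 * (\<Prod>n\<le>w. singular_factor n))"
proof -
  define h where "h n = (if prime n then (1 - 1 / real n) ^ 3 / (1 - rho n) else 1)" for n
  have hf: "h n * singular_factor n = (if n = 2 then 1 / 4 else if n = 3 then 4 / 9 else 1)" for n
  proof (cases "prime n \<and> n \<ge> 5")
    case True
    hence "1 - 1 / real n \<noteq> 0" "1 - 3 / real n \<noteq> 0" by auto
    thus ?thesis using True by (simp add: h_def singular_factor_def rho_def om_def)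
  next
    case False
    have "n = 2 \<or> n = 3" if "prime n"
    proof -
      have "n \<ge> 2" "n < 5" "n \<noteq> 4" using that False prime_ge_2_nat by auto
      thus ?thesis by linarith
    qed
    thus ?thesis using False by (auto simp: h_def singular_factor_def rho_def om_def power3_eq_cube)
  qed
  have "(\<Prod>p\<in>{p. prime p \<and> p \<le> w}. (1 - 1 / real p) ^ 3 / (1 - rho p)) = (\<Prod>p\<in>{p. prime p \<and> p \<le> w}. h p)"
    by (rule prod.cong) (auto simp: h_def)
  also have "\<dots> = (\<Prod>n\<le>w. h n)"
    by (rule prod.mono_neutral_left) (auto simp: h_def)
  finally have P: "(\<Prod>p\<in>{p. prime p \<and> p \<le> w}. (1 - 1 / real p) ^ 3 / (1 - rho p)) = (\<Prod>n\<le>w. h n)" .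
  have "(\<Prod>n\<le>w. h n) * (\<Prod>n\<le>w. singular_factor n) = (\<Prod>n\<le>w. if n = 2 then 1 / 4 else if n = 3 then 4 / 9 else 1)"
    by (simp only: hf flip: prod.distrib)
  also have "\<dots> = (\<Prod>n\<in>{2, 3::nat}. if n = 2 then 1 / 4 else if n = 3 then 4 / 9 else 1)"
    using assms by (intro prod.mono_neutral_right) auto
  also have "\<dots> = 1 / 9" by simp
  finally have *: "(\<Prod>n\<le>w. h n) * (\<Prod>n\<le>w. singular_factor n) = 1 / 9" .
  have "(\<Prod>n\<le>w. singular_factor n) > 0" by (intro prod_pos singular_factor_pos)
  hence "(\<Prod>n\<le>w. h n) = (1 / 9) / (\<Prod>n\<le>w. singular_factor n)"
    by (intro eq_divide_imp *) linarith
  thus ?thesis unfolding P by simp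
qed

text \<open>The threshold \<open>w\<close> is fixed before \<open>z\<close> grows, so the power of
  the product of small primes is a constant \<open>K\<close>, and \<open>ln z - ln K\<close> is
  asymptotic to \<open>ln z\<close>.\<close>

lemma sieve_sum_lower_asymptotics:
  assumes c: "c < 1 / (6 * singular_series_A)"
  shows "\<forall>\<^sub>F z in at_top. c * ln z ^ 3 \<le> sieve_sum z"
proof -
  \<comment> \<open>Two margins are needed: the gap above \<open>c1\<close> pays for stopping at a
    finite \<open>w\<close>, the gap below it for the shift by \<open>ln K\<close>.\<close>
  obtain c1 where c1: "c < c1" "c1 < 1 / (6 * singular_series_A)" using c dense by blast
  define A where "A w = (1 - 6 / real w) * (1 / (9 * (\<Prod>n\<le>w. singular_factor n))) / 6" for w :: nat
  have "(\<lambda>w. 1 - 6 / real w) \<longlonglongrightarrow> 1" by real_asymp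
  moreover have "(\<lambda>n. \<Prod>i\<le>n. singular_factor i) \<longlonglongrightarrow> prodinf singular_factor"
    by (rule convergent_prod_LIMSEQ[OF convergent_prod_singular_factor])
  ultimately have "A \<longlonglongrightarrow> 1 * (1 / (9 * prodinf singular_factor)) / 6"
    unfolding A_def using singular_series_A_pos
    by (intro tendsto_intros) (auto simp: singular_series_A_eq)
  also have "1 * (1 / (9 * prodinf singular_factor)) / 6 = 1 / (6 * singular_series_A)"
    by (simp add: singular_series_A_eq)
  finally have "\<forall>\<^sub>F w in sequentially. c1 < A w" using c1 by (simp add: order_tendsto_iff)
  moreover have "\<forall>\<^sub>F w in sequentially. w \<ge> 6" by (rule eventually_ge_at_top)
  ultimately have "\<forall>\<^sub>F w in sequentially. c1 < A w \<and> w \<ge> 6" by (rule eventually_conj)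
  then obtain w where w: "c1 < A w" "w \<ge> 6" using eventually_happens trivial_limit_sequentially by blast
  define K where "K = real (\<Prod>{p. prime p \<and> p \<le> w}) ^ 4"
  have "(\<Prod>{p. prime p \<and> p \<le> w}) > 0" using prime_gt_0_nat by (intro prod_pos) auto
  hence K: "K > 0" unfolding K_def by (simp del: of_nat_prod)
  have ge: "c1 * max 0 (ln (z / K)) ^ 3 \<le> sieve_sum z" if "z > 0" for z
  proof -
    have "c1 * max 0 (ln (z / K)) ^ 3 \<le> A w * max 0 (ln (z / K)) ^ 3"
      using w by (intro mult_right_mono) auto
    also have "A w * max 0 (ln (z / K)) ^ 3 \<le> sieve_sum z"
      using sieve_sum_ge[OF w(2) that] w unfolding A_def K_def by (subst (asm) prod_density_eq) auto
    finally show ?thesis .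
  qed
  have "((\<lambda>z::real. c1 * ((ln z - ln K) / ln z) ^ 3) \<longlongrightarrow> c1 * 1 ^ 3) at_top"
    by (intro tendsto_mult tendsto_power tendsto_const) real_asymp
  hence "\<forall>\<^sub>F z in at_top. c < c1 * ((ln z - ln K) / ln z) ^ 3"
    using c1 by (simp add: order_tendsto_iff)
  moreover have "\<forall>\<^sub>F z::real in at_top. z > max 1 K" by (rule eventually_gt_at_top)
  ultimately show ?thesis
  proof eventually_elim
    case (elim z)
    hence z: "z > 1" "z > K" by auto
    have "c * ln z ^ 3 \<le> c1 * ((ln z - ln K) / ln z) ^ 3 * ln z ^ 3"
      using elim z by (intro mult_right_mono) auto
    also have "\<dots> = c1 * (ln z - ln K) ^ 3" using z by (simp add: power_divide)
    also have "ln z - ln K = max 0 (ln (z / K))" using z K by (simp add: ln_div)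
    also have "c1 * max 0 (ln (z / K)) ^ 3 \<le> sieve_sum z" using ge z by simp
    finally show ?case .
  qed
qed

text \<open>By unique factorisation a set of primes is determined by its product, a natural number
  not exceeding \<open>z\<close>.\<close>

lemma card_sieve_support_le:
  assumes "z \<ge> 0"
  shows "real (card (sieve_support z)) \<le> z + 1"
proof -
  have fin: "finite T" and primes: "T \<subseteq> {p. prime p}" if "T \<in> sieve_support z" for T
    using that finite_subset[OF _ finite_primes_le_real[of z]] by (auto simp: sieve_support_def)
  have inj: "inj_on Prod (sieve_support z)"
  proof (rule inj_on_inverseI[of _ prime_factors])
    fix T assume T: "T \<in> sieve_support z"
    have "\<Prod>T \<noteq> 0" using primes[OF T] fin[OF T] by auto
    show "prime_factors (\<Prod>T) = T"
    proof
      show "prime_factors (\<Prod>T) \<subseteq> T"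
        using primes[OF T] fin[OF T] \<open>\<Prod>T \<noteq> 0\<close>
        by (auto simp: prime_factors_dvd prime_dvd_prod_iff)
           (metis mem_Collect_eq primes_dvd_imp_eq subsetD)
      show "T \<subseteq> prime_factors (\<Prod>T)"
        using primes[OF T] fin[OF T] \<open>\<Prod>T \<noteq> 0\<close>
        by (auto simp: prime_factors_dvd intro!: member_dvd_prod)
    qed
  qed
  have "card (sieve_support z) = card (Prod ` sieve_support z)" by (rule card_image[OF inj, symmetric])
  also have "\<dots> \<le> card {..nat \<lfloor>z\<rfloor>}"
    by (rule card_mono) (auto simp: sieve_support_def simp del: of_nat_prod intro!: le_nat_floor)
  finally have "real (card (sieve_support z)) \<le> real (nat \<lfloor>z\<rfloor>) + 1" by simp
  also have "real (nat \<lfloor>z\<rfloor>) \<le> z" using assms by simp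
  finally show ?thesis by simp
qed

text \<open>A prime \<open>p > K\<close> satisfies \<open>9 \<le> p powr \<delta>\<close>, so
  \<open>9 ^ card T\<close> is at most \<open>z powr \<delta>\<close> up to the bounded contribution
  of the primes up to \<open>K\<close>. With at most \<open>2 * z\<close> sets in the support,
  squaring gives the exponent \<open>2 + 2 * \<delta>\<close>.\<close>

lemma sieve_error_le:
  assumes "\<delta> > 0"
  shows "\<exists>C\<ge>0. \<forall>z\<ge>1. sieve_error z \<le> C * z powr (2 + 2 * \<delta>)"
proof -
  define K where "K = nat \<lceil>9 powr (1 / \<delta>)\<rceil>"
  have big: "9 \<le> real p powr \<delta>" if "p > K" for p
  proof -
    have "9 powr (1 / \<delta>) \<le> real p" using that unfolding K_def by linarith
    hence "(9 powr (1 / \<delta>)) powr \<delta> \<le> real p powr \<delta>" using assms by (intro powr_mono2) auto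
    thus ?thesis using assms by (simp add: powr_powr)
  qed
  have bound: "9 ^ card T \<le> 9 ^ (K + 1) * z powr \<delta>" if T: "T \<in> sieve_support z" for T z
  proof -
    have T': "T \<subseteq> {p. prime p}" "real (\<Prod>T) \<le> z" and fin: "finite T" 
      using T finite_subset[OF _ finite_primes_le_real[of z]] by (auto simp: sieve_support_def)
    have "(9::real) ^ card T = (\<Prod>p\<in>T. 9)" by simp
    also have "\<dots> \<le> (\<Prod>p\<in>T. (if p \<le> K then 9 else 1) * real p powr \<delta>)"
    proof (rule prod_mono)
      fix p assume "p \<in> T"
      hence "p \<ge> 1" using T' prime_ge_1_nat by auto
      hence "1 \<le> real p powr \<delta>" using assms by (intro ge_one_powr_ge_zero) auto
      thus "0 \<le> (9::real) \<and> 9 \<le> (if p \<le> K then 9 else 1) * real p powr \<delta>" using big[of p] by auto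
    qed
    also have "\<dots> = (\<Prod>p\<in>T. if p \<le> K then 9 else 1) * (\<Prod>p\<in>T. real p powr \<delta>)" by (rule prod.distrib)
    also have "(\<Prod>p\<in>T. real p powr \<delta>) = real (\<Prod>T) powr \<delta>"
      by (simp add: prod_powr_distrib)
    also have "(\<Prod>p\<in>T. if p \<le> K then 9 else 1 :: real) = 9 ^ card {p \<in> T. p \<le> K}"
      using fin by (simp flip: prod.inter_filter)
    also have "9 ^ card {p \<in> T. p \<le> K} * real (\<Prod>T) powr \<delta> \<le> 9 ^ (K + 1) * z powr \<delta>"
    proof (intro mult_mono power_increasing powr_mono2)
      have "card {p \<in> T. p \<le> K} \<le> card {..K}" by (rule card_mono) auto
      thus "card {p \<in> T. p \<le> K} \<le> K + 1" by simp
    qed (use T' assms in \<open>auto simp del: of_nat_prod\<close>)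
    finally show ?thesis .
  qed
  show ?thesis
  proof (intro exI[of _ "(2 * 9 ^ (K + 1))\<^sup>2"] conjI allI impI)
    fix z :: real assume z: "z \<ge> 1"
    have "(\<Sum>T\<in>sieve_support z. 9 ^ card T) \<le> (\<Sum>T\<in>sieve_support z. 9 ^ (K + 1) * z powr \<delta>)"
      by (intro sum_mono bound)
    also have "\<dots> = real (card (sieve_support z)) * (9 ^ (K + 1) * z powr \<delta>)" by simp
    also have "\<dots> \<le> (2 * z) * (9 ^ (K + 1) * z powr \<delta>)"
      using card_sieve_support_le[of z] z by (intro mult_right_mono) auto
    also have "\<dots> = (2 * 9 ^ (K + 1)) * z powr (1 + \<delta>)" using z by (simp add: powr_add)
    finally have "sieve_error z \<le> ((2 * 9 ^ (K + 1)) * z powr (1 + \<delta>))\<^sup>2"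
      unfolding sieve_error_def by (intro power_mono sum_nonneg) auto
    also have "\<dots> = (2 * 9 ^ (K + 1))\<^sup>2 * (z powr (1 + \<delta>) * z powr (1 + \<delta>))"
      by (simp add: power2_eq_square)
    also have "z powr (1 + \<delta>) * z powr (1 + \<delta>) = z powr (2 + 2 * \<delta>)"
      by (simp flip: powr_add)
    finally show "sieve_error z \<le> (2 * 9 ^ (K + 1))\<^sup>2 * z powr (2 + 2 * \<delta>)" .
  qed simp
qed

section \<open>Counting the primes\<close>

text \<open>The primes \<open>p \<le> x\<close> with \<open>p + 1 = 2 * a * q\<close> and
  \<open>p - 1 = 2 * b * r\<close> for primes \<open>q\<close> and \<open>r\<close>, parametrised by
  \<open>q\<close>.\<close>

definition chain_primes :: "real \<Rightarrow> nat \<Rightarrow> nat \<Rightarrow> nat set" where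
  "chain_primes x a b = (\<lambda>q. 2 * a * q - 1) `
     {q. prime q \<and> prime (2 * a * q - 1) \<and> (\<exists>r. prime r \<and> a * q = b * r + 1) \<and> real q \<le> (x + 1) / (2 * real a)}"

text \<open>An exponent of at least 2 forces its base below \<open>sqrt (x + 1)\<close>, so this set
  and \<open>power_plus\<close> catch the cases \<open>\<nu> \<ge> 2\<close> and
  \<open>\<mu> \<ge> 2\<close>. Primality is dropped, since a crude count suffices.\<close>

definition power_minus :: "real \<Rightarrow> nat \<Rightarrow> nat set" where
  "power_minus x L = (\<lambda>(\<gamma>, \<nu>, r). 2 ^ \<gamma> * r ^ \<nu> + 1) ` ({..L} \<times> {..L} \<times> {..nat \<lfloor>sqrt (x + 1)\<rfloor>})"

definition power_plus :: "real \<Rightarrow> nat \<Rightarrow> nat set" where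
  "power_plus x L = (\<lambda>(\<alpha>, \<beta>, \<mu>, q). 2 ^ \<alpha> * 3 ^ \<beta> * q ^ \<mu> - 1) `
     ({..L} \<times> {..L} \<times> {..L} \<times> {..nat \<lfloor>sqrt (x + 1)\<rfloor>})"

lemma finite_power_minus: "finite (power_minus x L)"
  and finite_power_plus: "finite (power_plus x L)"
  by (simp_all add: power_minus_def power_plus_def)

lemma card_power_minus:
  assumes "x \<ge> 0"
  shows "real (card (power_minus x L)) \<le> (real L + 1) ^ 2 * (sqrt (x + 1) + 1)"
proof -
  have "card (power_minus x L) \<le> card ({..L} \<times> {..L} \<times> {..nat \<lfloor>sqrt (x + 1)\<rfloor>})"
    unfolding power_minus_def by (rule card_image_le) simp
  hence "real (card (power_minus x L)) \<le> real ((L + 1) * ((L + 1) * (nat \<lfloor>sqrt (x + 1)\<rfloor> + 1)))"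
    by (simp only: of_nat_le_iff card_cartesian_product card_atMost Suc_eq_plus1)
  also have "\<dots> = (real L + 1) ^ 2 * (real (nat \<lfloor>sqrt (x + 1)\<rfloor>) + 1)"
    by (simp add: power2_eq_square algebra_simps)
  also have "\<dots> \<le> (real L + 1) ^ 2 * (sqrt (x + 1) + 1)"
    using assms by (intro mult_left_mono add_mono) auto
  finally show ?thesis .
qed

lemma card_power_plus:
  assumes "x \<ge> 0"
  shows "real (card (power_plus x L)) \<le> (real L + 1) ^ 3 * (sqrt (x + 1) + 1)"
proof -
  have "card (power_plus x L) \<le> card ({..L} \<times> {..L} \<times> {..L} \<times> {..nat \<lfloor>sqrt (x + 1)\<rfloor>})"
    unfolding power_plus_def by (rule card_image_le) simp
  hence "real (card (power_plus x L)) \<le> real ((L + 1) * ((L + 1) * ((L + 1) * (nat \<lfloor>sqrt (x + 1)\<rfloor> + 1))))"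
    by (simp only: of_nat_le_iff card_cartesian_product card_atMost Suc_eq_plus1)
  also have "\<dots> = (real L + 1) ^ 3 * (real (nat \<lfloor>sqrt (x + 1)\<rfloor>) + 1)"
    by (simp add: power3_eq_cube algebra_simps)
  also have "\<dots> \<le> (real L + 1) ^ 3 * (sqrt (x + 1) + 1)"
    using assms by (intro mult_left_mono add_mono) auto
  finally show ?thesis .
qed

lemma chain_primes_bound:
  fixes a b :: nat
  assumes ab: "a > 0" "b > 0" "coprime a b" "\<And>l. prime l \<Longrightarrow> l dvd a * b \<Longrightarrow> l < 5"
    and z: "z \<ge> 1" and x: "x \<ge> 0"
  shows "finite (chain_primes x a b)"
    and "real (card (chain_primes x a b)) \<le>
      ((x + 1) / (2 * real (a * b)) + 1) / sieve_sum z + sieve_error z + 3 * (z + 1)"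
proof -
  let ?C = "{q. prime q \<and> prime (2 * a * q - 1) \<and> (\<exists>r. prime r \<and> a * q = b * r + 1) \<and> real q \<le> (x + 1) / (2 * real a)}"
  have fin: "finite ?C"
    by (rule finite_subset[of _ "{..nat \<lfloor>(x + 1) / (2 * real a)\<rfloor>}"]) (auto simp: le_nat_floor)
  thus "finite (chain_primes x a b)" by (simp add: chain_primes_def)
  have "card (chain_primes x a b) \<le> card ?C" unfolding chain_primes_def by (rule card_image_le[OF fin])
  hence "real (card (chain_primes x a b)) \<le> real (card ?C)" by simp
  also have "\<dots> \<le> ((x + 1) / (2 * real a) / real b + 1) / sieve_sum z + sieve_error z + 3 * (z + 1)"
    by (rule card_prime_triples_le) (use assms in auto)
  finally show "real (card (chain_primes x a b)) \<le>
      ((x + 1) / (2 * real (a * b)) + 1) / sieve_sum z + sieve_error z + 3 * (z + 1)"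
    by (simp add: mult_ac)
qed

section \<open>Covering \<open>A_bar_le x\<close> by chains and higher powers\<close>

lemma exponent_le_log2:
  fixes c k :: nat and x :: real
  assumes "real (c ^ k) \<le> x + 1" "c \<ge> 2"
  shows "k \<le> nat \<lfloor>log 2 (x + 1)\<rfloor>"
proof (rule le_nat_floor)
  have "(2::nat) ^ k \<le> c ^ k" using assms by (intro power_mono) auto
  hence "real (2 ^ k) \<le> real (c ^ k)" by (simp only: of_nat_le_iff)
  hence "2 ^ k \<le> x + 1" using assms by simp
  moreover from this have "x + 1 > 0" using zero_less_power[of "2::real" k] by linarith
  ultimately show "real k \<le> log 2 (x + 1)" by (simp add: le_log_iff powr_realpow)
qed

lemma base_le_sqrt:
  fixes r \<nu> :: nat and x :: real
  assumes "real (r ^ \<nu>) \<le> x + 1" "\<nu> \<ge> 2" "r > 0"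
  shows "r \<le> nat \<lfloor>sqrt (x + 1)\<rfloor>"
proof (rule le_nat_floor)
  have "r ^ 2 \<le> r ^ \<nu>" using assms by (intro power_increasing) auto
  hence "real (r ^ 2) \<le> real (r ^ \<nu>)" by (simp only: of_nat_le_iff)
  hence "real r ^ 2 \<le> x + 1" using assms(1) by simp
  thus "real r \<le> sqrt (x + 1)" by (rule real_le_rsqrt)
qed

lemma A_bar_le_cover:
  assumes p: "p \<in> A_bar_le x"
  defines "L \<equiv> nat \<lfloor>log 2 (x + 1)\<rfloor>"
  shows "p \<in> power_minus x L \<union> power_plus x L \<union>
    (\<Union>(i, j)\<in>{1..L} \<times> {1..L}. chain_primes x (2 ^ i * 3 ^ j) 1 \<union> chain_primes x (3 ^ j) (2 ^ i))"
proof -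
  from p obtain \<alpha> \<beta> \<gamma> \<mu> \<nu> q r where pp: "prime p" and px: "real p \<le> x" and
    ge1: "\<alpha> \<ge> 1" "\<beta> \<ge> 1" "\<gamma> \<ge> 1" "\<mu> \<ge> 1" "\<nu> \<ge> 1" and
    qr: "prime q" "prime r" "gcd 6 (q * r) = 1" and
    plus: "p + 1 = 2 ^ \<alpha> * 3 ^ \<beta> * q ^ \<mu>" and minus: "p - 1 = 2 ^ \<gamma> * r ^ \<nu>"
    unfolding A_bar_le_def A_bar_def mem_Collect_eq by (elim conjE exE) (rule that; assumption)
  have p2: "p \<ge> 2" using pp by (rule prime_ge_2_nat)
  have q0: "q > 0" "q \<ge> 2" and r0: "r > 0" "r \<ge> 2" using qr prime_gt_0_nat prime_ge_2_nat by auto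
  have dvd_plus: "real d \<le> x + 1" if "d dvd p + 1" for d
  proof -
    have "d \<le> p + 1" using that by (rule dvd_imp_le) simp
    hence "real d \<le> real (p + 1)" by (simp only: of_nat_le_iff)
    thus ?thesis using px by simp
  qed
  have dvd_minus: "real d \<le> x + 1" if "d dvd p - 1" for d
  proof -
    have "d \<le> p - 1" using that p2 by (intro dvd_imp_le) auto
    hence "d \<le> p + 1" by simp
    hence "real d \<le> real (p + 1)" by (simp only: of_nat_le_iff)
    thus ?thesis using px by simp
  qed
  have dvds: "2 ^ \<alpha> dvd p + 1" "3 ^ \<beta> dvd p + 1" "q ^ \<mu> dvd p + 1" "2 ^ \<gamma> dvd p - 1" "r ^ \<nu> dvd p - 1"
    unfolding plus minus by simp_all
  note plus_le = dvd_plus[OF dvds(1)] dvd_plus[OF dvds(2)] dvd_plus[OF dvds(3)]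
  note minus_le = dvd_minus[OF dvds(4)] dvd_minus[OF dvds(5)]
  have aL: "\<alpha> \<le> L" unfolding L_def by (rule exponent_le_log2[OF plus_le(1)]) simp
  have bL: "\<beta> \<le> L" unfolding L_def by (rule exponent_le_log2[OF plus_le(2)]) simp
  have mL: "\<mu> \<le> L" unfolding L_def by (rule exponent_le_log2[OF plus_le(3) q0(2)])
  have gL: "\<gamma> \<le> L" unfolding L_def by (rule exponent_le_log2[OF minus_le(1)]) simp
  have nL: "\<nu> \<le> L" unfolding L_def by (rule exponent_le_log2[OF minus_le(2) r0(2)])
  consider "\<nu> \<ge> 2" | "\<mu> \<ge> 2" | "\<mu> = 1" "\<nu> = 1" using ge1 by linarith
  thus ?thesis
  proof cases
    case 1
    have "r \<le> nat \<lfloor>sqrt (x + 1)\<rfloor>"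
      by (rule base_le_sqrt[OF minus_le(2) 1 r0(1)])
    moreover have "p = 2 ^ \<gamma> * r ^ \<nu> + 1" using minus p2 by linarith
    ultimately have "p \<in> power_minus x L" unfolding power_minus_def using gL nL by force
    thus ?thesis by blast
  next
    case 2
    have "q \<le> nat \<lfloor>sqrt (x + 1)\<rfloor>"
      by (rule base_le_sqrt[OF plus_le(3) 2 q0(1)])
    moreover have "p = 2 ^ \<alpha> * 3 ^ \<beta> * q ^ \<mu> - 1" using plus by linarith
    ultimately have "p \<in> power_plus x L" unfolding power_plus_def using aL bL mL by force
    thus ?thesis by blast
  next
    case 3
    have odd_qr: "odd q" "odd r"
    proof -
      have "odd (q * r)"
      proof
        assume "even (q * r)"
        hence "2 dvd gcd 6 (q * r)" by (intro gcd_greatest) simp_all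
        thus False unfolding qr(3) by simp
      qed
      thus "odd q" "odd r" by simp_all
    qed
    obtain a' where a': "\<alpha> = Suc a'" using ge1 by (cases \<alpha>) auto
    obtain g' where g': "\<gamma> = Suc g'" using ge1 by (cases \<gamma>) auto
    have key: "2 ^ a' * 3 ^ \<beta> * q = 2 ^ g' * r + 1"
    proof -
      have "p + 1 = 2 * (2 ^ a' * 3 ^ \<beta> * q)" using plus 3 a' by simp
      moreover have "p - 1 = 2 * (2 ^ g' * r)" using minus 3 g' by simp
      ultimately show ?thesis using p2 by linarith
    qed
    \<comment> \<open>The two sides of \<open>key\<close> without the 1 are consecutive integers,
      exactly one of which is even; as \<open>q\<close> and \<open>r\<close> are odd, exactly one of
      the two powers of 2 is nontrivial.\<close>
    have parity: "a' = 0 \<longleftrightarrow> g' \<noteq> 0"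
    proof -
      have "even (2 ^ a' * 3 ^ \<beta> * q) \<longleftrightarrow> odd (2 ^ g' * r)" unfolding key by simp
      thus ?thesis using odd_qr by auto
    qed
    have mem: "p \<in> chain_primes x a b" if ab: "a * q = b * r + 1" "p + 1 = 2 * a * q" "a > 0" for a b :: nat
    proof -
      have eq: "p = 2 * a * q - 1" using ab(2) by linarith
      have "real (p + 1) = 2 * real a * real q" unfolding ab(2) by simp
      hence "2 * real a * real q \<le> x + 1" using px by simp
      hence "real q \<le> (x + 1) / (2 * real a)" using ab(3) by (simp add: field_simps)
      moreover have "prime (2 * a * q - 1)" using pp eq by simp
      ultimately show ?thesis unfolding chain_primes_def eq using qr ab(1) by (intro imageI) auto
    qed
    show ?thesis
    proof (cases "a' = 0")
      case True
      have "p \<in> chain_primes x (3 ^ \<beta>) (2 ^ g')"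
        by (rule mem) (use key plus True 3 a' in auto)
      moreover have "g' \<in> {1..L}" "\<beta> \<in> {1..L}" using True parity gL g' bL ge1 by auto
      ultimately show ?thesis by blast
    next
      case False
      have "p \<in> chain_primes x (2 ^ a' * 3 ^ \<beta>) 1"
        by (rule mem) (use key plus False parity 3 a' in auto)
      moreover have "a' \<in> {1..L}" "\<beta> \<in> {1..L}" using False aL a' bL ge1 by auto
      ultimately show ?thesis by blast
    qed
  qed
qed

section \<open>Summation over the chains and passage to the limit\<close>

lemma sum_geometric_le:
  fixes c :: real
  assumes "c > 1"
  shows "(\<Sum>i\<in>{1..L}. 1 / c ^ i) \<le> 1 / (c - 1)"
proof -
  have "(\<Sum>i\<in>{1..L}. 1 / c ^ i) = (1 - 1 / c ^ L) / (c - 1)"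
  proof (induction L)
    case (Suc L)
    have "(1 - u) / (c - 1) + u / c = (1 - u / c) / (c - 1)" for u
      using assms by (simp add: field_simps)
    from this[of "1 / c ^ L"] show ?case using Suc by (simp add: mult.commute)
  qed simp
  also have "\<dots> \<le> 1 / (c - 1)" using assms by (intro divide_right_mono) auto
  finally show ?thesis .
qed

text \<open>For each \<open>(i, j)\<close> both kinds of chain have the same product
  \<open>2 ^ i * 3 ^ j\<close> of coefficients, so together they contribute
  \<open>(x + 1) / S\<close> times \<open>1 / (2 ^ i * 3 ^ j)\<close>. The remaining terms are
  \<open>L ^ 2\<close> pairs of sieve errors and the two sets of higher powers.\<close>

lemma card_A_bar_le:
  assumes x: "x \<ge> 0" and z: "z \<ge> 1"
  defines "L \<equiv> nat \<lfloor>log 2 (x + 1)\<rfloor>"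
  shows "real (card (A_bar_le x)) \<le> (x + 1) / (2 * sieve_sum z) +
     2 * real L ^ 2 * (sieve_error z + 3 * z + 4) + 2 * (real L + 1) ^ 3 * (sqrt (x + 1) + 1)"
proof -
  let ?I = "{1..L} \<times> {1..L}"
  define S where "S = sieve_sum z"
  define E where "E = sieve_error z + 3 * (z + 1)"
  have S: "S \<ge> 1" unfolding S_def by (rule sieve_sum_ge_1[OF z])
  let ?U = "\<lambda>(i, j). chain_primes x (2 ^ i * 3 ^ j) 1 \<union> chain_primes x (3 ^ j) (2 ^ i)"
  have small: "l < 5" if "prime l" "l dvd 2 ^ i * 3 ^ j" for l i j :: nat
  proof -
    have "l dvd 2 \<or> l dvd 3" using that prime_dvd_power by (auto simp: prime_dvd_mult_iff)
    thus ?thesis using dvd_imp_le[of l 2] dvd_imp_le[of l 3] by auto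
  qed
  have small': "l < 5" if "prime l" "l dvd 3 ^ j * 2 ^ i" for l i j :: nat
    using small[OF that(1)] that(2) by (simp add: mult.commute)
  have "coprime (3::nat) 2" by (rule primes_coprime) auto
  hence cop: "coprime ((3::nat) ^ j) (2 ^ i)" for i j by simp
  have b1: "finite (chain_primes x (2 ^ i * 3 ^ j) 1)"
    "real (card (chain_primes x (2 ^ i * 3 ^ j) 1)) \<le> ((x + 1) / (2 * real (2 ^ i * 3 ^ j * 1)) + 1) / S + E" for i j
    using chain_primes_bound[of "2 ^ i * 3 ^ j" 1 z x] small[of _ i j] x z by (simp_all add: S_def E_def)
  have b2: "finite (chain_primes x (3 ^ j) (2 ^ i))"
    "real (card (chain_primes x (3 ^ j) (2 ^ i))) \<le> ((x + 1) / (2 * real (3 ^ j * 2 ^ i)) + 1) / S + E" for i j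
    using chain_primes_bound[of "3 ^ j" "2 ^ i" z x] cop small'[of _ j i] x z by (simp_all add: S_def E_def)
  have U: "finite (?U t) \<and> real (card (?U t)) \<le> (x + 1) / S * (1 / 2 ^ fst t * (1 / 3 ^ snd t)) + 2 * (1 + E)" for t
  proof -
    obtain i j where t: "t = (i, j)" by (cases t)
    have "real (card (?U t)) \<le> real (card (chain_primes x (2 ^ i * 3 ^ j) 1) + card (chain_primes x (3 ^ j) (2 ^ i)))"
      unfolding t prod.case by (simp only: of_nat_le_iff card_Un_le)
    also have "\<dots> \<le> (((x + 1) / (2 * real (2 ^ i * 3 ^ j * 1)) + 1) / S + E) + (((x + 1) / (2 * real (3 ^ j * 2 ^ i)) + 1) / S + E)"
      unfolding of_nat_add by (intro add_mono b1 b2)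
    also have "\<dots> = (x + 1) / S * (1 / 2 ^ i * (1 / 3 ^ j)) + 2 * (1 / S + E)"
      using S by (simp add: field_simps)
    also have "\<dots> \<le> (x + 1) / S * (1 / 2 ^ i * (1 / 3 ^ j)) + 2 * (1 + E)"
    proof -
      have "1 / S \<le> 1" using S by simp
      thus ?thesis by (intro add_left_mono mult_left_mono add_right_mono) auto
    qed
    finally show ?thesis using b1 b2 by (simp add: t)
  qed
  have "A_bar_le x \<subseteq> power_minus x L \<union> power_plus x L \<union> (\<Union>t\<in>?I. ?U t)"
    using A_bar_le_cover unfolding L_def by blast
  hence "card (A_bar_le x) \<le> card (power_minus x L \<union> power_plus x L \<union> (\<Union>t\<in>?I. ?U t))"
    using U by (intro card_mono finite_UnI finite_UN_I finite_power_minus finite_power_plus) auto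
  also have "\<dots> \<le> card (power_minus x L \<union> power_plus x L) + card (\<Union>t\<in>?I. ?U t)" by (rule card_Un_le)
  also have "\<dots> \<le> card (power_minus x L) + card (power_plus x L) + (\<Sum>t\<in>?I. card (?U t))"
    by (intro add_mono card_Un_le card_UN_le) auto
  finally have "real (card (A_bar_le x)) \<le> real (card (power_minus x L)) + real (card (power_plus x L)) +
     (\<Sum>t\<in>?I. real (card (?U t)))" by (simp only: of_nat_le_iff flip: of_nat_add of_nat_sum)
  also have "\<dots> \<le> (real L + 1) ^ 2 * (sqrt (x + 1) + 1) + (real L + 1) ^ 3 * (sqrt (x + 1) + 1) +
     (\<Sum>t\<in>?I. (x + 1) / S * (1 / 2 ^ fst t * (1 / 3 ^ snd t)) + 2 * (1 + E))"
    using U by (intro add_mono card_power_minus card_power_plus sum_mono x) blast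
  also have "(\<Sum>t\<in>?I. (x + 1) / S * (1 / 2 ^ fst t * (1 / 3 ^ snd t)) + 2 * (1 + E)) =
     (x + 1) / S * (\<Sum>t\<in>?I. (1 / 2 ^ fst t * (1 / 3 ^ snd t))) + real L ^ 2 * (2 * (1 + E))"
    by (simp add: sum.distrib sum_distrib_left power2_eq_square)
  also have "(\<Sum>t\<in>?I. (1 / 2 ^ fst t * (1 / 3 ^ snd t))) = (\<Sum>i\<in>{1..L}. 1 / 2 ^ i) * (\<Sum>j\<in>{1..L}. 1 / 3 ^ j :: real)"
    unfolding sum_product sum.cartesian_product by (simp add: split_def)
  \<comment> \<open>The geometric sums are at most 1 and \<open>1 / 2\<close>, which gives the main
    term \<open>(x + 1) / (2 * S)\<close>.\<close>
  also have "(x + 1) / S * ((\<Sum>i\<in>{1..L}. 1 / 2 ^ i) * (\<Sum>j\<in>{1..L}. 1 / 3 ^ j)) \<le> (x + 1) / S * (1 / (2 - 1) * (1 / (3 - 1)))"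
    using S x by (intro mult_left_mono mult_mono sum_geometric_le) (auto intro: sum_nonneg)
  also have "(real L + 1) ^ 2 * (sqrt (x + 1) + 1) \<le> (real L + 1) ^ 3 * (sqrt (x + 1) + 1)"
    using x by (intro mult_right_mono power_increasing) auto
  finally show ?thesis by (simp add: S_def E_def algebra_simps)
qed

text \<open>The sieve is applied with \<open>z = x powr h\<close>, where
  \<open>h = 1 / 2 - \<epsilon>\<close>. Then \<open>ln z = h * ln x\<close>, which puts
  \<open>h ^ 3\<close> into the main term, and everything else is of smaller order than
  \<open>x / ln x ^ 3\<close>.\<close>

lemma Limsup_A_bar_le_level:
  fixes c \<epsilon> :: real
  assumes c: "0 < c" "c < 1 / (6 * singular_series_A)" and \<epsilon>: "0 < \<epsilon>" "\<epsilon> < 1 / 2"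
  shows "Limsup at_top (\<lambda>x::real. ereal (real (card (A_bar_le x)) / (x / (ln x) ^ 3)))
     \<le> ereal (1 / (2 * c * (1 / 2 - \<epsilon>) ^ 3))"
proof -
  define h where "h = 1 / 2 - \<epsilon>"
  have h: "0 < h" "h < 1 / 2" using \<epsilon> by (auto simp: h_def)
  \<comment> \<open>The exponent of \<open>x\<close> in the sieve error when
    \<open>sieve_error_le\<close> is used with \<open>\<delta> = \<epsilon>\<close>; it equals
    \<open>1 - \<epsilon> - 2 * \<epsilon> ^ 2\<close>, so a power of \<open>x\<close> is
    saved.\<close>
  define e where "e = h * (2 + 2 * \<epsilon>)"
  have "e = 1 - \<epsilon> - 2 * \<epsilon> ^ 2" by (simp add: e_def h_def algebra_simps power2_eq_square)
  hence e: "e < 1" using \<epsilon> zero_le_power2[of \<epsilon>] by linarith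
  obtain C where C: "C \<ge> 0" "\<And>z. z \<ge> 1 \<Longrightarrow> sieve_error z \<le> C * z powr (2 + 2 * \<epsilon>)"
    using sieve_error_le[OF \<epsilon>(1)] by blast
  let ?M = "\<lambda>x::real. (x + 1) / x * (1 / (2 * c * h ^ 3)) +
     (2 * log 2 (x + 1) ^ 2 * (C * x powr e + 3 * x powr h + 4) + 2 * (log 2 (x + 1) + 1) ^ 3 * (sqrt (x + 1) + 1)) / (x / ln x ^ 3)"
  have lim1: "((\<lambda>x::real. (x + 1) / x * (1 / (2 * c * h ^ 3))) \<longlongrightarrow> 1 * (1 / (2 * c * h ^ 3))) at_top"
    by (intro tendsto_mult tendsto_const) real_asymp
  have l1: "((\<lambda>x::real. 2 * log 2 (x + 1) ^ 2 * (x powr e) / (x / ln x ^ 3)) \<longlongrightarrow> 0) at_top"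
    using e by real_asymp
  have l2: "((\<lambda>x::real. 2 * log 2 (x + 1) ^ 2 * (x powr h) / (x / ln x ^ 3)) \<longlongrightarrow> 0) at_top"
    using h by real_asymp
  have l3: "((\<lambda>x::real. (2 * log 2 (x + 1) ^ 2 * 4 + 2 * (log 2 (x + 1) + 1) ^ 3 * (sqrt (x + 1) + 1)) / (x / ln x ^ 3)) \<longlongrightarrow> 0) at_top"
    by real_asymp
  have "((\<lambda>x::real. (x + 1) / x * (1 / (2 * c * h ^ 3)) + (C * (2 * log 2 (x + 1) ^ 2 * (x powr e) / (x / ln x ^ 3)) +
     3 * (2 * log 2 (x + 1) ^ 2 * (x powr h) / (x / ln x ^ 3)) +
     (2 * log 2 (x + 1) ^ 2 * 4 + 2 * (log 2 (x + 1) + 1) ^ 3 * (sqrt (x + 1) + 1)) / (x / ln x ^ 3))) \<longlongrightarrow>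
     1 * (1 / (2 * c * h ^ 3)) + (C * 0 + 3 * 0 + 0)) at_top"
    by (intro tendsto_add lim1 tendsto_mult tendsto_const l1 l2 l3)
  hence lim: "(?M \<longlongrightarrow> 1 / (2 * c * h ^ 3)) at_top"
    by (simp add: add_divide_distrib algebra_simps)
  have "filterlim (\<lambda>x::real. x powr h) at_top at_top" using h by real_asymp
  hence "\<forall>\<^sub>F x in at_top. c * ln (x powr h) ^ 3 \<le> sieve_sum (x powr h)"
    using eventually_compose_filterlim[OF sieve_sum_lower_asymptotics[OF c(2)]] by blast
  moreover have "\<forall>\<^sub>F x::real in at_top. x > 1" by (rule eventually_gt_at_top)
  ultimately have bound: "\<forall>\<^sub>F x in at_top. real (card (A_bar_le x)) / (x / ln x ^ 3) \<le> ?M x"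
  proof eventually_elim
    case (elim x)
    define z where "z = x powr h"
    have z: "z \<ge> 1" unfolding z_def using elim h by (intro ge_one_powr_ge_zero) auto
    have lnx: "ln x > 0" using elim by simp
    have logx: "log 2 (x + 1) \<ge> 0" using elim by simp
    define L where "L = nat \<lfloor>log 2 (x + 1)\<rfloor>"
    have L: "real L \<le> log 2 (x + 1)" unfolding L_def using logx by simp
    have S: "c * h ^ 3 * ln x ^ 3 \<le> sieve_sum z"
      using elim by (simp add: z_def ln_powr power_mult_distrib mult_ac)
    have Epow: "z powr (2 + 2 * \<epsilon>) = x powr e" by (simp add: z_def e_def powr_powr)
    have E: "sieve_error z \<le> C * x powr e" using C(2)[OF z] Epow by simp
    have "real (card (A_bar_le x)) \<le> (x + 1) / (2 * sieve_sum z) +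
     2 * real L ^ 2 * (sieve_error z + 3 * z + 4) + 2 * (real L + 1) ^ 3 * (sqrt (x + 1) + 1)"
      unfolding L_def by (rule card_A_bar_le[OF _ z]) (use elim in auto)
    also have "\<dots> \<le> (x + 1) / (2 * (c * h ^ 3 * ln x ^ 3)) + 
       2 * log 2 (x + 1) ^ 2 * (C * x powr e + 3 * z + 4) + 2 * (log 2 (x + 1) + 1) ^ 3 * (sqrt (x + 1) + 1)"
      using S E L elim c h lnx z sieve_error_nonneg[of z] sieve_sum_ge_1[OF z]
      by (intro add_mono mult_mono power_mono divide_left_mono mult_left_mono) (auto intro!: mult_pos_pos)
    finally have "real (card (A_bar_le x)) / (x / ln x ^ 3) \<le> ((x + 1) / (2 * (c * h ^ 3 * ln x ^ 3)) + 
       2 * log 2 (x + 1) ^ 2 * (C * x powr e + 3 * z + 4) + 2 * (log 2 (x + 1) + 1) ^ 3 * (sqrt (x + 1) + 1)) / (x / ln x ^ 3)"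
      using elim lnx by (intro divide_right_mono) auto
    also have "\<dots> = (x + 1) / (2 * (c * h ^ 3 * ln x ^ 3)) / (x / ln x ^ 3) + 
       (2 * log 2 (x + 1) ^ 2 * (C * x powr e + 3 * z + 4) + 2 * (log 2 (x + 1) + 1) ^ 3 * (sqrt (x + 1) + 1)) / (x / ln x ^ 3)"
      by (simp only: add_divide_distrib add.assoc)
    also have "(x + 1) / (2 * (c * h ^ 3 * ln x ^ 3)) / (x / ln x ^ 3) = (x + 1) / x * (1 / (2 * c * h ^ 3))"
      using lnx by simp
    finally show ?case by (simp only: z_def)
  qed
  have "((\<lambda>x. ereal (?M x)) \<longlongrightarrow> ereal (1 / (2 * c * h ^ 3))) at_top"
    using lim by (rule tendsto_ereal)
  hence "Limsup at_top (\<lambda>x. ereal (?M x)) = ereal (1 / (2 * c * h ^ 3))"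
    by (intro lim_imp_Limsup) auto
  moreover have "Limsup at_top (\<lambda>x::real. ereal (real (card (A_bar_le x)) / (x / (ln x) ^ 3))) \<le> Limsup at_top (\<lambda>x. ereal (?M x))"
    using bound by (intro Limsup_mono) (simp only: ereal_less_eq)
  ultimately show ?thesis by (simp add: h_def)
qed

theorem theorem2p2:
  "Limsup at_top (\<lambda>x::real. ereal (real (card (A_bar_le x)) / (x / (ln x) ^ 3)))
     \<le> ereal (24 * singular_series_A)"
proof -
  let ?A = singular_series_A
  have A: "?A > 0" by (rule singular_series_A_pos)
  \<comment> \<open>One parameter drives both limits: \<open>c = (1 - t) / (6 * ?A)\<close> and
    \<open>\<epsilon> = t\<close>. At \<open>t = 0\<close> the value is
    \<open>6 * ?A * 2 ^ 3 / 2 = 24 * ?A\<close>, and the limit superior, which does not depend on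
    \<open>t\<close>, is bounded by the limit of \<open>?g\<close>.\<close>
  let ?g = "\<lambda>t::real. 1 / (2 * ((1 - t) / (6 * ?A)) * (1 / 2 - t) ^ 3)"
  have "(?g \<longlongrightarrow> 1 / (2 * ((1 - 0) / (6 * ?A)) * (1 / 2 - 0) ^ 3)) (at_right 0)"
    using A by (intro tendsto_intros) auto
  hence "(?g \<longlongrightarrow> 24 * ?A) (at_right 0)" by (simp add: power3_eq_cube)
  hence lim: "((\<lambda>t. ereal (?g t)) \<longlongrightarrow> ereal (24 * ?A)) (at_right 0)" by (rule tendsto_ereal)
  have "\<forall>\<^sub>F t::real in at_right 0. t \<in> {0<..<1/2}"
    by (rule eventually_at_right_real) simp
  hence "\<forall>\<^sub>F t in at_right 0. Limsup at_top (\<lambda>x::real. ereal (real (card (A_bar_le x)) / (x / (ln x) ^ 3))) \<le> ereal (?g t)"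
  proof eventually_elim
    case (elim t)
    thus ?case using A by (intro Limsup_A_bar_le_level) (auto simp: field_simps)
  qed
  thus ?thesis by (rule tendsto_lowerbound[OF lim]) simp
qed

end
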